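(* Let $h,f,t_0,g$ be as in the context, suppose $f$ has generalized exponential growth of type $(q,p)$ with $q\in[1,2)$, and let $\{(\lambda_n,\mu_n,u_n)\}$ be a sequence of solutions (as defined in the context) such that $\mu_n\to\infty$ as $n\to\infty$. Let $(r_{k,n})$ be the concentration centers described in the context. Then for each $k\in\mathbb N$, $$g(u_n(r_{k,n}))+\log g'(u_n(r_{k,n}))=2\log\frac1{\sqrt{\lambda_n}\,r_{k,n}}+\log\frac{a_k^2}{2h(0)}+o(1)$$ as $n\to\infty$ up to a subsequence. Moreover, there exists a sequence $(r_{k,n}^* )$ with $r_{k,n}^*\in(r_{k,n},r_{k+1,n})$ such that $$\frac{u_n(r_{k,n}^* )}{\mu_n}\to\delta_k^*\ \text{ if } q>1,\qquad u_n(r_{k,n}^* )=\mu_n-\Big(\log\frac1{\eta_k^*}+o(1)\Big)\frac{g(\mu_n)}{g'(\mu_n)}\ \text{ if } q=1,$$ and $$g(u_n(r_{k,n}^* ))=(\alpha_{q,k}^*+o(1))\log\frac1{\sqrt{\lambda_n}\,r_{k,n}^*}$$ as $n\to\infty$ up to a subsequence. In particular, assuming additionally $\inf_{t>0}f(t)/t>0$ if $q=1$, we have for all $q\in[1,2)$ $$g(u_n(r_{k,n}))=(2+o(1))\log\frac1{r_{k,n}}\qquad\text{and}\qquad g(u_n(r_{k,n}^* ))=(\alpha_{q,k}^*+o(1))\log\frac1{r_{k,n}^*}$$ as $n\to\infty$ up to a subsequence.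
   Context: **Nonlinearity.** Put $\exp_1(t)=e^t$ and $\exp_k(t)=\exp(\exp_{k-1}(t))$ for $k\ge2$, $t\ge 0$. Throughout, $h:[0,1]\to(0,\infty)$ and $f:[0,\infty)\to[0,\infty)$ are continuously differentiable, $t_0\ge0$ is such that $f(t)>0$ for all $t\ge t_0$ and $f\in C^2([t_0,\infty))$, and $g(t)=\log f(t)$ for $t\ge t_0$. We say that $f$ has generalized exponential growth of type $(q,p)$, where $(q,p)\in\{1\}\times(0,\infty]\,\cup\,(1,\infty)\times(0,\infty)$, if (a) $g'(t)>0$, $g''(t)>0$ for all $t\ge t_0$, $\lim_{t\to\infty}\frac{g'(t)^2}{g(t)g''(t)}=q$ and $\lim_{t\to\infty}\frac{tg'(t)}{g(t)}=p$; (b) if $q=1$: $tg'(t)/g(t)$ is nondecreasing for $t\ge t_0$, and there exist $m\in\mathbb N$ and $\hat g\in C^2([t_0,\infty))$ such that $f(t)=\exp_m(\hat g(t))$ and $\hat g'(t)/\hat g(t)$ is nonincreasing for all $t\ge t_0$. It is known that then $1/p+1/q=1$ (with $1/\infty=0$); so $q\in[1,2)$ means $p\in(2,\infty]$, with $p=\infty$ iff $q=1$. **Sequence of solutions.** $(\lambda_n,\mu_n,u_n)\in(0,\infty)\times(0,\infty)\times C^2([0,1])$ with, for all $n\in\mathbb N$, $$-u_n''-\tfrac1r u_n'=\lambda_n h f(u_n),\ u_n>0\ \text{in }(0,1),\qquad u_n(0)=\mu_n,\ u_n'(0)=0=u_n(1).$$ **Constants.** Let $q\in[1,2)$, $1/p+1/q=1$.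 Set $a_1=2,\delta_1=1,\eta_1=1$. If $q>1$, define $(a_k)\subset(0,2]$, $(\delta_k)\subset(0,1]$ inductively by $$\tfrac{2p}{2+a_k}\Big(1-\tfrac{\delta_{k+1}}{\delta_k}\Big)-1+\Big(\tfrac{\delta_{k+1}}{\delta_k}\Big)^p=0,\ \ \delta_{k+1}<\delta_k,\qquad a_{k+1}=2-\Big(\tfrac{\delta_{k+1}}{\delta_k}\Big)^{p-1}(2+a_k),$$ and $\eta_k=\delta_k^p$. If $q=1$, define $(a_k),(\eta_k)\subset(0,2]$ inductively by $$\tfrac{2}{2+a_k}\log\tfrac{\eta_k}{\eta_{k+1}}-1+\tfrac{\eta_{k+1}}{\eta_k}=0,\ \ \eta_{k+1}<\eta_k,\qquad a_{k+1}=2-\tfrac{\eta_{k+1}}{\eta_k}(2+a_k),$$ and $\delta_k=1$ for all $k$. Put $b_k=(\sqrt2/a_k)^{a_k}$ and $z_k(r)=\log\frac{2a_k^2b_k}{r^{2-a_k}(1+b_kr^{a_k})^2}$ (for $r\ge0$ if $k=1$, $r>0$ if $k>1$). If $q\in(1,2)$ put $$\delta_k^*=\Big(1-\frac{a_k}{2(p-1)}\Big)\delta_k,\qquad \alpha_{q,k}^*=(2+a_k)\Big(1-\frac{a_k}{2(p-1)}\Big)^{p-1},$$ and if $q=1$ put $$\eta_k^*=e^{-a_k/2}\eta_k,\qquad \alpha_{1,k}^*=(2+a_k)e^{-a_k/2}.$$ **Concentration sequences.** Let $q\in[1,2)$ and $\mu_n\to\infty$. It is known from earlier work that, after passing to a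 subsequence, for every $k\in\mathbb N$ there are sequences $(r_{k,n})\subset(0,1)$ (the concentration centers), $\gamma_{k,n}>0$ and $(\rho_{k,n}),(\bar\rho_{k,n})\subset[0,1)$, with $\bar\rho_{1,n}=0$ for all $n$, such that as $n\to\infty$: (1) $u_n(s_n)/\mu_n\to\delta_k$ for $(s_n)=(r_{k,n}),(\rho_{k,n}),(\bar\rho_{k,n})$, and if $q=1$, moreover $u_n(s_n)=\mu_n-(\log\frac1{\eta_k}+o(1))\frac{g(\mu_n)}{g'(\mu_n)}$ for these three sequences; (2) $\lambda_nr_{k,n}^2h(r_{k,n})f'(u_n(r_{k,n}))\to a_k^2/2$; (3) $\lambda_nh(r_{k,n})f'(u_n(r_{k,n}))\gamma_{k,n}^2=1$ for large $n$, and $\gamma_{k,n}\to0$; (4) $\rho_{k,n}\to0$, $\bar\rho_{k,n}/\gamma_{k,n}\to0$, $\rho_{k,n}/\gamma_{k,n}\to\infty$; (5) $z_{k,n}(r):=g'(u_n(r_{k,n}))(u_n(\gamma_{k,n}r)-u_n(r_{k,n}))$, $r\in[0,1/\gamma_{k,n}]$, satisfies $\|z_{k,n}-z_k\|_{C^2_{\mathrm{loc}}([\bar\rho_{k,n}/\gamma_{k,n},\rho_{k,n}/\gamma_{k,n}])}\to0$ (in particular $C^2$ convergence on compact subsets of $(0,\infty)$, and of $[0,\infty)$ if $k=1$); (6) $g'(u_n(r_{k,n}))\int_{\bar\rho_{k,n}}^{\rho_{k,n}}\lambda_nhf(u_n)r\,dr\to2a_k$, $\int_{\bar\rho_{k,n}}^{\rho_{k,n}}\lambda_nhf'(u_n)r\,dr\to2a_k$,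 and $g'(\mu_n)\int_{\rho_{k,n}}^{\bar\rho_{k+1,n}}\lambda_nhf(u_n)r\,dr\to0$; (7) if $q>1$, or if $q=1$ and $\inf_{t>0}f(t)/t>0$: $\frac{\log(1/\lambda_n)}{g(\mu_n)}\to0$ and $\frac{\log(1/r_{k,n})}{g(\mu_n)}\to\frac{\eta_k}2$; (8) $\frac{\log(\rho_{k,n}/\gamma_{k,n})}{g(u_n(r_{k,n}))}\to0$, $\frac{\log(\bar\rho_{k,n}/\gamma_{k,n})}{g(u_n(r_{k,n}))}\to0$ (the latter for $k\ne1$), and $$\sup_{r\in[\bar\rho_{k,n}/\gamma_{k,n},\,\rho_{k,n}/\gamma_{k,n}]}\left|\frac{(\gamma_{k,n}r)^2\lambda_nh(\gamma_{k,n}r)f'(u_n(\gamma_{k,n}r))}{r^2e^{z_k(r)}}-1\right|\to0 .$$ Such sequences (along such a subsequence) are fixed. *)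

theory Defs
  imports "HOL-Analysis.Analysis"
begin

section \<open>One-sided calculus on intervals\<close>

text \<open>
  All functions live on intervals that contain some of their end points, so derivatives are taken
  within the domain \<open>S\<close>: they are one-sided at an end point and two-sided in the interior.
\<close>

definition wderiv :: "real set \<Rightarrow> (real \<Rightarrow> real) \<Rightarrow> real \<Rightarrow> real" where
  "wderiv S \<phi> x = vector_derivative \<phi> (at x within S)"

definition C1_on :: "real set \<Rightarrow> (real \<Rightarrow> real) \<Rightarrow> bool" where
  "C1_on S \<phi> \<longleftrightarrow> \<phi> differentiable_on S \<and> continuous_on S (wderiv S \<phi>)"

definition C2_on :: "real set \<Rightarrow> (real \<Rightarrow> real) \<Rightarrow> bool" where
  "C2_on S \<phi> \<longleftrightarrow> C1_on S \<phi> \<and> C1_on S (wderiv S \<phi>)"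

text \<open>\<open>X\<^sub>n = (c + o(1)) Y\<^sub>n\<close> as \<open>n \<rightarrow> \<infinity>\<close>.\<close>

definition asymp_factor :: "(nat \<Rightarrow> real) \<Rightarrow> real \<Rightarrow> (nat \<Rightarrow> real) \<Rightarrow> bool" where
  "asymp_factor X c Y \<longleftrightarrow>
     (\<exists>\<epsilon>. \<epsilon> \<longlonglongrightarrow> 0 \<and> (\<forall>\<^sub>F n in sequentially. X n = (c + \<epsilon> n) * Y n))"


section \<open>Generalized exponential growth\<close>

text \<open>
  The logarithm \<open>g = log f\<close> is only meaningful on \<open>[t\<^sub>0, \<infinity>)\<close>, and \<open>g'\<close>, \<open>g''\<close> are taken there.
  The growth exponent \<open>p\<close> may be \<open>\<infinity>\<close>, so it is an extended real. The \<open>m\<close>-fold exponential is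
  defined for \<open>m \<ge> 1\<close> and nonnegative arguments, whence the condition \<open>0 \<le> gh t\<close> on
  the function \<open>gh\<close> (g-hat).
\<close>

definition log_of :: "(real \<Rightarrow> real) \<Rightarrow> real \<Rightarrow> real" where
  "log_of f t = ln (f t)"

definition gen_exp_growth :: "(real \<Rightarrow> real) \<Rightarrow> real \<Rightarrow> real \<Rightarrow> ereal \<Rightarrow> bool" where
  "gen_exp_growth f t0 q p \<longleftrightarrow>
     (let g = log_of f; g' = wderiv {t0..} g; g'' = wderiv {t0..} g' in
       (q = 1 \<and> 0 < p \<or> 1 < q \<and> 0 < p \<and> p < \<infinity>) \<and>
       (\<forall>t\<ge>t0. g' t > 0 \<and> g'' t > 0) \<and>
       ((\<lambda>t. (g' t)\<^sup>2 / (g t * g'' t)) \<longlongrightarrow> q) at_top \<and>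
       ((\<lambda>t. ereal (t * g' t / g t)) \<longlongrightarrow> p) at_top \<and>
       (q = 1 \<longrightarrow>
          mono_on {t0..} (\<lambda>t. t * g' t / g t) \<and>
          (\<exists>m\<ge>1. \<exists>gh. C2_on {t0..} gh \<and>
             (\<forall>t\<ge>t0. 0 \<le> gh t \<and> f t = (exp ^^ m) (gh t)) \<and>
             antimono_on {t0..} (\<lambda>t. wderiv {t0..} gh t / gh t))))"


section \<open>Sequences of solutions\<close>

definition solution_seq ::
    "(real \<Rightarrow> real) \<Rightarrow> (real \<Rightarrow> real) \<Rightarrow> (nat \<Rightarrow> real) \<Rightarrow> (nat \<Rightarrow> real) \<Rightarrow> (nat \<Rightarrow> real \<Rightarrow> real) \<Rightarrow> bool" where
  "solution_seq h f lam \<mu> u \<longleftrightarrow>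
     (\<forall>n. 0 < lam n \<and> 0 < \<mu> n \<and> C2_on {0..1} (u n) \<and>
        (\<forall>x\<in>{0<..<1}.
           - wderiv {0..1} (wderiv {0..1} (u n)) x - 1 / x * wderiv {0..1} (u n) x
             = lam n * h x * f (u n x) \<and>
           0 < u n x) \<and>
        u n 0 = \<mu> n \<and> wderiv {0..1} (u n) 0 = 0 \<and> u n 1 = 0)"


section \<open>The constants\<close>

text \<open>
  All constants depend on \<open>q\<close> only, since \<open>1/p + 1/q = 1\<close> determines the exponent \<open>p\<close>.
  Sequences are indexed by \<open>k \<ge> 1\<close>; the value at \<open>k = 0\<close> is irrelevant. The implicit equation
  for the next \<open>\<delta>\<close> (or \<open>\<eta>\<close>) has exactly one solution by \<open>unique_interior_root\<close>;
  the resulting recursions are \<open>conc_constants_gt1\<close> and \<open>conc_constants_eq1\<close> below.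
\<close>

definition conj_exponent :: "real \<Rightarrow> real" where
  "conj_exponent q = q / (q - 1)"

definition next_delta :: "real \<Rightarrow> real \<Rightarrow> real \<Rightarrow> real" where
  "next_delta p a d =
     (THE d'. 0 < d' \<and> d' < d \<and> 2 * p / (2 + a) * (1 - d' / d) - 1 + (d' / d) powr p = 0)"

definition next_eta :: "real \<Rightarrow> real \<Rightarrow> real" where
  "next_eta a e =
     (THE e'. 0 < e' \<and> e' < e \<and> 2 / (2 + a) * ln (e / e') - 1 + e' / e = 0)"

text \<open>The map \<open>(a\<^sub>k, \<delta>\<^sub>k) \<mapsto> (a\<^bsub>k+1\<^esub>, \<delta>\<^bsub>k+1\<^esub>)\<close> if \<open>q > 1\<close>, and
  \<open>(a\<^sub>k, \<eta>\<^sub>k) \<mapsto> (a\<^bsub>k+1\<^esub>, \<eta>\<^bsub>k+1\<^esub>)\<close> if \<open>q = 1\<close>.\<close>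

definition const_step :: "real \<Rightarrow> real \<times> real \<Rightarrow> real \<times> real" where
  "const_step q = (\<lambda>(a, d).
     if q > 1 then
       (let p = conj_exponent q; d' = next_delta p a d
        in (2 - (d' / d) powr (p - 1) * (2 + a), d'))
     else
       (let d' = next_eta a d in (2 - d' / d * (2 + a), d')))"

definition const_pair :: "real \<Rightarrow> nat \<Rightarrow> real \<times> real" where
  "const_pair q k = (const_step q ^^ (k - 1)) (2, 1)"

definition a_const :: "real \<Rightarrow> nat \<Rightarrow> real" where
  "a_const q k = fst (const_pair q k)"

definition delta_const :: "real \<Rightarrow> nat \<Rightarrow> real" where
  "delta_const q k = (if q > 1 then snd (const_pair q k) else 1)"

definition eta_const :: "real \<Rightarrow> nat \<Rightarrow> real" where
  "eta_const q k =
     (if q > 1 then delta_const q k powr conj_exponent q else snd (const_pair q k))"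

definition b_const :: "real \<Rightarrow> nat \<Rightarrow> real" where
  "b_const q k = (sqrt 2 / a_const q k) powr a_const q k"

text \<open>Since \<open>0 powr 0 = 0\<close> in the library, the factor \<open>r\<^bsup>2 - a\<^esup>\<close> needs the convention \<open>0\<^sup>0 = 1\<close>
  for \<open>k = 1\<close>, where \<open>a = 2\<close> and \<open>r = 0\<close> is allowed.\<close>

definition z_prof :: "real \<Rightarrow> nat \<Rightarrow> real \<Rightarrow> real" where
  "z_prof q k r =
     (let a = a_const q k; b = b_const q k
      in ln (2 * a\<^sup>2 * b / ((if a = 2 then 1 else r powr (2 - a)) * (1 + b * r powr a)\<^sup>2)))"

definition z_dom :: "nat \<Rightarrow> real set" where
  "z_dom k = (if k = 1 then {0..} else {0<..})"

definition delta_star :: "real \<Rightarrow> nat \<Rightarrow> real" where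
  "delta_star q k = (1 - a_const q k / (2 * (conj_exponent q - 1))) * delta_const q k"

definition eta_star :: "real \<Rightarrow> nat \<Rightarrow> real" where
  "eta_star q k = exp (- a_const q k / 2) * eta_const q k"

definition alpha_star :: "real \<Rightarrow> nat \<Rightarrow> real" where
  "alpha_star q k =
     (if q > 1 then
        (2 + a_const q k) *
        (1 - a_const q k / (2 * (conj_exponent q - 1))) powr (conj_exponent q - 1)
      else (2 + a_const q k) * exp (- a_const q k / 2))"


section \<open>Concentration sequences\<close>

text \<open>\<open>v\<^sub>n = \<mu>\<^sub>n - (c + o(1)) g(\<mu>\<^sub>n) / g'(\<mu>\<^sub>n)\<close>\<close>

definition peak_expansion ::
    "(real \<Rightarrow> real) \<Rightarrow> real \<Rightarrow> (nat \<Rightarrow> real) \<Rightarrow> (nat \<Rightarrow> real) \<Rightarrow> real \<Rightarrow> bool" where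
  "peak_expansion f t0 \<mu> v c \<longleftrightarrow>
     (\<exists>\<epsilon>. \<epsilon> \<longlonglongrightarrow> 0 \<and>
        (\<forall>\<^sub>F n in sequentially.
           v n = \<mu> n - (c + \<epsilon> n) * (log_of f (\<mu> n) / wderiv {t0..} (log_of f) (\<mu> n))))"

text \<open>
  Local \<open>C\<^sup>2\<close> convergence of \<open>\<zeta>\<^sub>n\<close>, given on \<open>[0, R\<^sub>n]\<close> with \<open>R\<^sub>n \<rightarrow> \<infinity>\<close>, to \<open>z\<close>, given on \<open>S\<close>.
\<close>

definition C2_loc_conv ::
    "(nat \<Rightarrow> real) \<Rightarrow> (nat \<Rightarrow> real \<Rightarrow> real) \<Rightarrow> real set \<Rightarrow> (real \<Rightarrow> real) \<Rightarrow> bool" where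
  "C2_loc_conv R \<zeta> S z \<longleftrightarrow>
     (\<forall>K. compact K \<and> K \<subseteq> S \<longrightarrow>
        uniform_limit K \<zeta> z sequentially \<and>
        uniform_limit K (\<lambda>n. wderiv {0..R n} (\<zeta> n)) (wderiv S z) sequentially \<and>
        uniform_limit K (\<lambda>n. wderiv {0..R n} (wderiv {0..R n} (\<zeta> n)))
          (wderiv S (wderiv S z)) sequentially)"

definition linear_lower_bound :: "(real \<Rightarrow> real) \<Rightarrow> bool" where
  "linear_lower_bound f \<longleftrightarrow> 0 < (INF t\<in>{0<..}. f t / t)"

text \<open>
  The arguments \<open>r k n\<close> (concentration centers), \<open>\<gamma> k n\<close>, \<open>\<rho> k n\<close>, \<open>\<rho>b k n\<close> (rho-bar), \<open>k \<ge> 1\<close>,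
  belong to the \<open>n\<close>-th member of the given sequence of solutions. The rescaled functions converge
  locally on the intervals \<open>[\<rho>b k n / \<gamma> k n, \<rho> k n / \<gamma> k n]\<close>; since these exhaust \<open>z_dom k\<close>, this is
  convergence on compact subsets of \<open>z_dom k\<close>. In the final uniform estimate the point \<open>x = 0\<close>,
  which occurs for \<open>k = 1\<close> and where the quotient has the form \<open>0 / 0\<close>, is left out.
\<close>

definition concentration_sequences ::
    "real \<Rightarrow> (real \<Rightarrow> real) \<Rightarrow> (real \<Rightarrow> real) \<Rightarrow> real \<Rightarrow>
     (nat \<Rightarrow> real) \<Rightarrow> (nat \<Rightarrow> real) \<Rightarrow> (nat \<Rightarrow> real \<Rightarrow> real) \<Rightarrow>
     (nat \<Rightarrow> nat \<Rightarrow> real) \<Rightarrow> (nat \<Rightarrow> nat \<Rightarrow> real) \<Rightarrow> (nat \<Rightarrow> nat \<Rightarrow> real) \<Rightarrow> (nat \<Rightarrow> nat \<Rightarrow> real) \<Rightarrow> bool"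
  where
  "concentration_sequences q h f t0 lam \<mu> u r \<gamma> \<rho> \<rho>b \<longleftrightarrow>
   (let f' = wderiv {0..} f; g = log_of f; g' = wderiv {t0..} g in
    (\<forall>n. \<rho>b 1 n = 0) \<and>
    (\<forall>k\<ge>1.
      (\<forall>n. r k n \<in> {0<..<1} \<and> 0 < \<gamma> k n \<and> \<rho> k n \<in> {0..<1} \<and> \<rho>b k n \<in> {0..<1}) \<and>

      (\<forall>s\<in>{r k, \<rho> k, \<rho>b k}.
         (\<lambda>n. u n (s n) / \<mu> n) \<longlonglongrightarrow> delta_const q k \<and>
         (q = 1 \<longrightarrow> peak_expansion f t0 \<mu> (\<lambda>n. u n (s n)) (ln (1 / eta_const q k)))) \<and>

      (\<lambda>n. lam n * (r k n)\<^sup>2 * h (r k n) * f' (u n (r k n))) \<longlonglongrightarrow> (a_const q k)\<^sup>2 / 2 \<and>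

      (\<forall>\<^sub>F n in sequentially. lam n * h (r k n) * f' (u n (r k n)) * (\<gamma> k n)\<^sup>2 = 1) \<and>
      \<gamma> k \<longlonglongrightarrow> 0 \<and>

      \<rho> k \<longlonglongrightarrow> 0 \<and>
      (\<lambda>n. \<rho>b k n / \<gamma> k n) \<longlonglongrightarrow> 0 \<and>
      filterlim (\<lambda>n. \<rho> k n / \<gamma> k n) at_top sequentially \<and>

      C2_loc_conv (\<lambda>n. 1 / \<gamma> k n)
        (\<lambda>n x. g' (u n (r k n)) * (u n (\<gamma> k n * x) - u n (r k n)))
        (z_dom k) (z_prof q k) \<and>

      (\<lambda>n. g' (u n (r k n)) *
         integral {\<rho>b k n..\<rho> k n} (\<lambda>x. lam n * h x * f (u n x) * x)) \<longlonglongrightarrow> 2 * a_const q k \<and>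
      (\<lambda>n. integral {\<rho>b k n..\<rho> k n} (\<lambda>x. lam n * h x * f' (u n x) * x))
         \<longlonglongrightarrow> 2 * a_const q k \<and>
      (\<lambda>n. g' (\<mu> n) *
         integral {\<rho> k n..\<rho>b (k + 1) n} (\<lambda>x. lam n * h x * f (u n x) * x)) \<longlonglongrightarrow> 0 \<and>

      (q > 1 \<or> q = 1 \<and> linear_lower_bound f \<longrightarrow>
         (\<lambda>n. ln (1 / lam n) / g (\<mu> n)) \<longlonglongrightarrow> 0 \<and>
         (\<lambda>n. ln (1 / r k n) / g (\<mu> n)) \<longlonglongrightarrow> eta_const q k / 2) \<and>

      (\<lambda>n. ln (\<rho> k n / \<gamma> k n) / g (u n (r k n))) \<longlonglongrightarrow> 0 \<and>
      (k \<noteq> 1 \<longrightarrow> (\<lambda>n. ln (\<rho>b k n / \<gamma> k n) / g (u n (r k n))) \<longlonglongrightarrow> 0) \<and>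
      (\<forall>\<epsilon>>0. \<forall>\<^sub>F n in sequentially.
         \<forall>x\<in>{\<rho>b k n / \<gamma> k n..\<rho> k n / \<gamma> k n}. 0 < x \<longrightarrow>
           \<bar>(\<gamma> k n * x)\<^sup>2 * lam n * h (\<gamma> k n * x) * f' (u n (\<gamma> k n * x))
              / (x\<^sup>2 * exp (z_prof q k x)) - 1\<bar> \<le> \<epsilon>)))"


section \<open>The constants are well defined\<close>

lemma unique_interior_root:
  fixes \<phi> D :: "real \<Rightarrow> real"
  assumes der: "\<And>x. 0 < x \<Longrightarrow> (\<phi> has_real_derivative D x) (at x)"
    and mono: "\<And>x y. 0 < x \<Longrightarrow> x < y \<Longrightarrow> D x < D y"
    and end1: "\<phi> 1 = 0" "D 1 > 0"
    and start: "0 < s" "s < 1" "\<phi> s > 0"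
  shows "\<exists>!x. 0 < x \<and> x < 1 \<and> \<phi> x = 0"
    and "\<And>x. 0 < x \<Longrightarrow> x < 1 \<Longrightarrow> \<phi> x = 0 \<Longrightarrow> D x < 0"
proof -
  have crit: "\<exists>z. x < z \<and> z < y \<and> D z = 0" if "0 < x" "x < y" "\<phi> x = \<phi> y" for x y
  proof -
    have "\<exists>z. x < z \<and> z < y \<and> \<phi> y - \<phi> x = (y - x) * D z"
      by (rule MVT2) (use that in \<open>auto intro: der\<close>)
    then show ?thesis using that by auto
  qed
  obtain d where d: "0 < d" "\<And>e. 0 < e \<Longrightarrow> e < d \<Longrightarrow> \<phi> (1 - e) < \<phi> 1"
    using DERIV_pos_inc_left[OF der[of 1] end1(2)] by auto
  define e where "e = min (d / 2) ((1 - s) / 2)"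
  have e: "0 < e" "e < d" "s < 1 - e" "\<phi> (1 - e) < 0"
    using d(1) d(2)[of e] start end1 by (auto simp: e_def min_def field_simps)
  have "\<exists>x\<ge>s. x \<le> 1 - e \<and> \<phi> x = 0"
  proof (rule IVT2')
    show "continuous_on {s..1 - e} \<phi>"
      by (intro continuous_at_imp_continuous_on ballI DERIV_isCont[OF der]) (use start in auto)
  qed (use e start in auto)
  then obtain x where x: "s \<le> x" "x \<le> 1 - e" "\<phi> x = 0" by blast
  have uniq: "\<not> x < y" if xy: "0 < x" "y < 1" "\<phi> x = 0" "\<phi> y = 0" for x y
  proof
    assume "x < y"
    then obtain z where "x < z" "z < y" "D z = 0"
      using crit[of x y] xy by auto
    moreover obtain w where "y < w" "w < 1" "D w = 0"
      using crit[of y 1] \<open>x < y\<close> xy end1 by auto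
    ultimately show False using mono[of z w] xy by auto
  qed
  show "\<exists>!x. 0 < x \<and> x < 1 \<and> \<phi> x = 0"
  proof (rule ex1I[of _ x])
    show "0 < x \<and> x < 1 \<and> \<phi> x = 0" using x start e by auto
    show "y = x" if "0 < y \<and> y < 1 \<and> \<phi> y = 0" for y
      using uniq[of x y] uniq[of y x] that x start e by force
  qed
  show "D x < 0" if x0: "0 < x" "x < 1" "\<phi> x = 0" for x
  proof -
    obtain z where "x < z" "D z = 0" using crit[of x 1] x0 end1 by auto
    then show ?thesis using mono[of x z] x0 by auto
  qed
qed

lemma next_delta_props:
  fixes p a d :: real
  assumes "2 < p" "0 < a" "a \<le> 2" "0 < d"
  defines "d' \<equiv> next_delta p a d"
  shows "0 < d'" "d' < d" "2 * p / (2 + a) * (1 - d' / d) - 1 + (d' / d) powr p = 0"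
    "(d' / d) powr (p - 1) * (2 + a) < 2"
proof -
  define c where "c = 2 * p / (2 + a)"
  define \<phi> where "\<phi> = (\<lambda>x. c * (1 - x) - 1 + x powr p)"
  define D where "D = (\<lambda>x. p * x powr (p - 1) - c)"
  have c: "1 < c" "c < p" using assms(1-4) by (auto simp: c_def field_simps)
  have der: "(\<phi> has_real_derivative D x) (at x)" if "0 < x" for x
    unfolding \<phi>_def D_def using that by (auto intro!: derivative_eq_intros)
  have mono: "D x < D y" if "0 < x" "x < y" for x y
    using that assms(1) by (auto simp: D_def powr_less_mono2)
  have ends: "\<phi> 1 = 0" "D 1 > 0" using c by (auto simp: \<phi>_def D_def)
  define s where "s = (1 - 1 / c) / 2"
  have s: "0 < s" "s < 1" using c by (auto simp: s_def field_simps)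
  have "c * (1 - s) - 1 > 0" using c by (auto simp: s_def field_simps)
  then have s': "\<phi> s > 0" using s by (simp add: \<phi>_def add_pos_nonneg)
  note root = unique_interior_root[of \<phi> D s, OF der mono ends s s']
  obtain x where x: "0 < x" "x < 1" "\<phi> x = 0"
    and un: "\<And>y. 0 < y \<Longrightarrow> y < 1 \<Longrightarrow> \<phi> y = 0 \<Longrightarrow> y = x"
    using root(1) by blast
  have "d' = x * d"
    unfolding d'_def next_delta_def
  proof (rule the_equality)
    show "0 < x * d \<and> x * d < d \<and>
        2 * p / (2 + a) * (1 - x * d / d) - 1 + (x * d / d) powr p = 0"
      using x assms by (auto simp: \<phi>_def c_def)
    show "y = x * d" if "0 < y \<and> y < d \<and>
        2 * p / (2 + a) * (1 - y / d) - 1 + (y / d) powr p = 0" for y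
    proof -
      have "y / d = x"
        by (rule un) (use that assms(1-4) in \<open>auto simp: \<phi>_def c_def\<close>)
      then show ?thesis using assms(4) by auto
    qed
  qed
  then have d': "d' / d = x" "d' = x * d" using assms by auto
  show "0 < d'" "d' < d" "2 * p / (2 + a) * (1 - d' / d) - 1 + (d' / d) powr p = 0"
    using d' x assms(4) by (auto simp: \<phi>_def c_def)
  have "p * x powr (p - 1) < c" using root(2)[of x] x by (simp add: D_def)
  then have "p * (x powr (p - 1) * (2 + a)) < p * 2"
    using assms(2) by (simp add: c_def field_simps)
  then show "(d' / d) powr (p - 1) * (2 + a) < 2"
    using assms(1) d' by simp
qed

lemma next_eta_props:
  fixes a e :: real
  assumes "0 < a" "a \<le> 2" "0 < e"
  defines "e' \<equiv> next_eta a e"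
  shows "0 < e'" "e' < e" "2 / (2 + a) * ln (e / e') - 1 + e' / e = 0"
    "e' / e * (2 + a) < 2"
proof -
  define c where "c = 2 / (2 + a)"
  define \<phi> where "\<phi> = (\<lambda>x. c * ln (1 / x) - 1 + x)"
  define D where "D = (\<lambda>x. 1 - c / x)"
  have c: "0 < c" "c < 1" using assms(1-3) by (auto simp: c_def field_simps)
  have der: "(\<phi> has_real_derivative D x) (at x)" if "0 < x" for x
    unfolding \<phi>_def D_def using that
    by (auto intro!: derivative_eq_intros simp: field_simps power2_eq_square)
  have mono: "D x < D y" if "0 < x" "x < y" for x y
    using that c by (auto simp: D_def divide_strict_left_mono)
  have ends: "\<phi> 1 = 0" "D 1 > 0" using c by (auto simp: \<phi>_def D_def)
  define s where "s = exp (- 2 / c)"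
  have s: "0 < s" "s < 1" using c by (auto simp: s_def)
  have s': "\<phi> s > 0" using s c by (simp add: \<phi>_def s_def ln_div add_pos_pos)
  note root = unique_interior_root[of \<phi> D s, OF der mono ends s s']
  obtain x where x: "0 < x" "x < 1" "\<phi> x = 0"
    and un: "\<And>y. 0 < y \<Longrightarrow> y < 1 \<Longrightarrow> \<phi> y = 0 \<Longrightarrow> y = x"
    using root(1) by blast
  have "e' = x * e"
    unfolding e'_def next_eta_def
  proof (rule the_equality)
    show "0 < x * e \<and> x * e < e \<and> 2 / (2 + a) * ln (e / (x * e)) - 1 + x * e / e = 0"
      using x assms by (auto simp: \<phi>_def c_def)
    show "y = x * e"
      if "0 < y \<and> y < e \<and> 2 / (2 + a) * ln (e / y) - 1 + y / e = 0" for y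
    proof -
      have "1 / (y / e) = e / y" by simp
      then have "y / e = x"
        by (intro un) (use that assms(1-3) in \<open>auto simp: \<phi>_def c_def\<close>)
      then show ?thesis using assms(3) by auto
    qed
  qed
  then have e': "e' / e = x" "e' = x * e" using assms by auto
  show "0 < e'" "e' < e" "2 / (2 + a) * ln (e / e') - 1 + e' / e = 0"
    using e' x assms(3) by (auto simp: \<phi>_def c_def)
  have "x < c" using root(2)[of x] x by (simp add: D_def field_simps)
  then show "e' / e * (2 + a) < 2"
    using assms(1) e' by (simp add: c_def field_simps)
qed

lemma const_pair_Suc: "k \<ge> 1 \<Longrightarrow> const_pair q (k + 1) = const_step q (const_pair q k)"
  unfolding const_pair_def by (cases k) simp_all

lemma const_pair_range:
  assumes "1 \<le> q" "q < 2" "k \<ge> 1"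
  shows "0 < fst (const_pair q k) \<and> fst (const_pair q k) \<le> 2 \<and>
         0 < snd (const_pair q k) \<and> snd (const_pair q k) \<le> 1"
  using assms(3)
proof (induction k rule: dec_induct)
  case base
  then show ?case by (simp add: const_pair_def)
next
  case (step k)
  obtain a d where ad: "const_pair q k = (a, d)" by (cases "const_pair q k")
  with step have r: "0 < a" "a \<le> 2" "0 < d" "d \<le> 1" by auto
  have nx: "const_pair q (Suc k) = const_step q (a, d)"
    using const_pair_Suc[of k q] step ad by simp
  show ?case
  proof (cases "q > 1")
    case True
    then have p: "2 < conj_exponent q" using assms by (simp add: conj_exponent_def field_simps)
    show ?thesis
      using next_delta_props[OF p r(1-3)] r True nx
      by (simp add: const_step_def Let_def)
  next
    case False
    show ?thesis
      using next_eta_props[OF r(1-3)] r False nx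
      by (simp add: const_step_def Let_def)
  qed
qed

lemma conc_constants_1:
  "a_const q 1 = 2" "delta_const q 1 = 1" "eta_const q 1 = 1"
  by (auto simp: a_const_def delta_const_def eta_const_def const_pair_def)

lemma conc_constants_gt1:
  assumes "1 < q" "q < 2" "k \<ge> 1"
  defines "p \<equiv> conj_exponent q"
  shows "0 < a_const q k" "a_const q k \<le> 2" "0 < delta_const q k" "delta_const q k \<le> 1"
    "delta_const q (k + 1) < delta_const q k"
    "2 * p / (2 + a_const q k) * (1 - delta_const q (k + 1) / delta_const q k) - 1
       + (delta_const q (k + 1) / delta_const q k) powr p = 0"
    "a_const q (k + 1)
       = 2 - (delta_const q (k + 1) / delta_const q k) powr (p - 1) * (2 + a_const q k)"
proof -
  obtain a d where ad: "const_pair q k = (a, d)" by (cases "const_pair q k")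
  have r: "0 < a" "a \<le> 2" "0 < d" "d \<le> 1"
    using const_pair_range[of q k] assms ad by auto
  have p: "2 < p" using assms by (simp add: conj_exponent_def field_simps)
  note props = next_delta_props[OF p r(1-3)]
  have nx: "const_pair q (k + 1)
      = (2 - (next_delta p a d / d) powr (p - 1) * (2 + a), next_delta p a d)"
    using const_pair_Suc[of k q] assms ad by (simp add: const_step_def Let_def)
  show "0 < a_const q k" "a_const q k \<le> 2" "0 < delta_const q k" "delta_const q k \<le> 1"
    "delta_const q (k + 1) < delta_const q k"
    "2 * p / (2 + a_const q k) * (1 - delta_const q (k + 1) / delta_const q k) - 1
       + (delta_const q (k + 1) / delta_const q k) powr p = 0"
    "a_const q (k + 1)
       = 2 - (delta_const q (k + 1) / delta_const q k) powr (p - 1) * (2 + a_const q k)"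
    using r props nx ad assms(1) by (simp_all add: a_const_def delta_const_def)
qed

lemma conc_constants_eq1:
  assumes "k \<ge> 1"
  shows "0 < a_const 1 k" "a_const 1 k \<le> 2" "0 < eta_const 1 k" "eta_const 1 k \<le> 1"
    "eta_const 1 (k + 1) < eta_const 1 k"
    "2 / (2 + a_const 1 k) * ln (eta_const 1 k / eta_const 1 (k + 1)) - 1
       + eta_const 1 (k + 1) / eta_const 1 k = 0"
    "a_const 1 (k + 1) = 2 - eta_const 1 (k + 1) / eta_const 1 k * (2 + a_const 1 k)"
proof -
  obtain a d where ad: "const_pair 1 k = (a, d)" by (cases "const_pair 1 k")
  have r: "0 < a" "a \<le> 2" "0 < d" "d \<le> 1"
    using const_pair_range[of 1 k] assms ad by auto
  note props = next_eta_props[OF r(1-3)]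
  have nx: "const_pair 1 (k + 1) = (2 - next_eta a d / d * (2 + a), next_eta a d)"
    using const_pair_Suc[of k 1] assms ad by (simp add: const_step_def Let_def)
  show "0 < a_const 1 k" "a_const 1 k \<le> 2" "0 < eta_const 1 k" "eta_const 1 k \<le> 1"
    "eta_const 1 (k + 1) < eta_const 1 k"
    "2 / (2 + a_const 1 k) * ln (eta_const 1 k / eta_const 1 (k + 1)) - 1
       + eta_const 1 (k + 1) / eta_const 1 k = 0"
    "a_const 1 (k + 1) = 2 - eta_const 1 (k + 1) / eta_const 1 k * (2 + a_const 1 k)"
    using r props nx ad by (simp_all add: a_const_def eta_const_def)
qed

end

theory Submission
  imports Defs
begin

text \<open>
  Write \<open>G = g / g'\<close> and \<open>F\<^sub>n(x) = - x u\<^sub>n'(x)\<close>. The first expansion is the logarithm of the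
  asymptotics of \<open>\<lambda>\<^sub>n r\<^sup>2 h(r) f'(u\<^sub>n(r))\<close> at a concentration centre, because \<open>f' = g' e\<^sup>g\<close>.

  Between two bubbles the monotone flux \<open>F\<^sub>n\<close> is asymptotically constant: the limit profile together
  with the mass of the bubble gives \<open>g'(u\<^sub>n(r\<^sub>k)) F\<^sub>n \<rightarrow> 2 + a\<^sub>k\<close> on \<open>[\<rho>\<^sub>k, \<rho>b\<^bsub>k+1\<^esub>]\<close>. Hence \<open>u\<^sub>n\<close>
  is there asymptotically linear in \<open>ln x\<close>, and the intermediate value theorem provides a radius
  \<open>r\<^sup>*\<close> with \<open>u\<^sub>n(r\<^sup>*) = \<mu>\<^sub>n - c G(\<mu>\<^sub>n)\<close> for the desired \<open>c\<close> and an expansion of \<open>ln (1 / r\<^sup>*)\<close>.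
  The growth assumption enters through \<open>G' \<rightarrow> 1 - 1/q\<close>, which controls how \<open>g\<close> and \<open>G\<close> change
  from \<open>\<mu>\<^sub>n\<close> to \<open>\<mu>\<^sub>n - (c + o(1)) G(\<mu>\<^sub>n)\<close>.
\<close>

section \<open>Asymptotics of convex functions with a growth rate\<close>

text \<open>The order of \<open>a\<close> and \<open>b\<close> is left open because in
  \<open>regularly_varying\<close> the point \<open>Y n\<close> may lie on either side of
  \<open>X n\<close>.\<close>

lemma cauchy_mvt:
  fixes \<phi> \<psi> \<phi>' \<psi>' :: "real \<Rightarrow> real"
  assumes ab: "a \<noteq> b"
    and d: "\<And>x. min a b \<le> x \<Longrightarrow> x \<le> max a b \<Longrightarrow> (\<phi> has_real_derivative \<phi>' x) (at x)"
      "\<And>x. min a b \<le> x \<Longrightarrow> x \<le> max a b \<Longrightarrow> (\<psi> has_real_derivative \<psi>' x) (at x)"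
  shows "\<exists>\<xi>. min a b < \<xi> \<and> \<xi> < max a b \<and> (\<phi> b - \<phi> a) * \<psi>' \<xi> = (\<psi> b - \<psi> a) * \<phi>' \<xi>"
proof -
  have "\<exists>\<xi>. min a b < \<xi> \<and> \<xi> < max a b \<and>
      (\<phi> (max a b) - \<phi> (min a b)) * \<psi>' \<xi> = (\<psi> (max a b) - \<psi> (min a b)) * \<phi>' \<xi>"
    by (rule GMVT') (use ab d in \<open>auto intro: DERIV_isCont simp: min_def max_def\<close>)
  then show ?thesis by (auto simp: min_def max_def algebra_simps split: if_splits)
qed

text \<open>To be applied to \<open>g = log f\<close> with \<open>T = t0\<close>. Only points beyond
  \<open>T\<close> occur, where derivatives within \<open>{t0..}\<close> are two-sided.\<close>

locale convex_growth =
  fixes g g1 g2 :: "real \<Rightarrow> real" and T q :: real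
  assumes q_ge_1: "1 \<le> q"
    and deriv_g: "T < t \<Longrightarrow> (g has_real_derivative g1 t) (at t)"
    and deriv_g1: "T < t \<Longrightarrow> (g1 has_real_derivative g2 t) (at t)"
    and g1_pos: "T < t \<Longrightarrow> 0 < g1 t"
    and g2_pos: "T < t \<Longrightarrow> 0 < g2 t"
    and growth_rate: "((\<lambda>t. (g1 t)\<^sup>2 / (g t * g2 t)) \<longlongrightarrow> q) at_top"
begin

text \<open>The reciprocal of the logarithmic derivative of \<open>g\<close>, that is, the distance
  over which \<open>ln g\<close> changes by about one. It is the natural unit for depths below the
  maximum \<open>\<mu> n\<close>.\<close>

definition G :: "real \<Rightarrow> real" where
  "G t = g t / g1 t"

lemma g1_mono: "T < s \<Longrightarrow> s \<le> t \<Longrightarrow> g1 s \<le> g1 t"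
  by (rule DERIV_nonneg_imp_nondecreasing[of s t g1])
     (auto intro!: exI deriv_g1 less_imp_le[OF g2_pos])

text \<open>A convex function lies above its tangent, and the tangent at \<open>s\<close> has
  positive slope.\<close>

lemma g_at_top: "filterlim g at_top at_top"
proof (rule filterlim_at_top_mono)
  define s where "s = T + 1"
  have s: "T < s" by (simp add: s_def)
  show "filterlim (\<lambda>t. g s + g1 s * (t - s)) at_top at_top"
    using g1_pos[OF s] filterlim_tendsto_add_at_top[OF tendsto_const filterlim_ident, of "- s"]
    by (intro filterlim_tendsto_add_at_top[OF tendsto_const]
        filterlim_tendsto_pos_mult_at_top[OF tendsto_const]) auto
  show "\<forall>\<^sub>F t in at_top. g s + g1 s * (t - s) \<le> g t"
    using eventually_gt_at_top[of s]
  proof eventually_elim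
    case (elim t)
    then obtain z where z: "s < z" "z < t" "g t - g s = (t - s) * g1 z"
      using MVT2[of s t g g1] deriv_g s by force
    have "(t - s) * g1 s \<le> (t - s) * g1 z"
      using g1_mono[of s z] z s elim by (intro mult_left_mono) auto
    then show ?case using z by (simp add: algebra_simps)
  qed
qed

lemma eventually_g_pos: "\<forall>\<^sub>F t in at_top. T < t \<and> 0 < g t"
  using eventually_gt_at_top[of T] filterlim_at_top_dense[THEN iffD1, OF g_at_top, rule_format, of 0]
  by eventually_elim auto

lemma eventually_G_pos:
  assumes "filterlim X at_top F"
  shows "\<forall>\<^sub>F n in F. 0 < G (X n)"
proof -
  have "\<forall>\<^sub>F t in at_top. 0 < G t"
    using eventually_g_pos by eventually_elim (auto simp: G_def g1_pos)
  then show ?thesis using assms unfolding filterlim_iff by blast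
qed

lemma threshold: obtains S where "T < S" "\<And>t. S \<le> t \<Longrightarrow> 0 < g t"
proof -
  obtain S where "\<forall>t\<ge>S. T < t \<and> 0 < g t"
    using eventually_g_pos by (auto simp: eventually_at_top_linorder)
  then show thesis by (intro that[of S]) auto
qed

lemma inverse_rate: "((\<lambda>t. g t * g2 t / (g1 t)\<^sup>2) \<longlongrightarrow> 1 / q) at_top"
  using tendsto_inverse[OF growth_rate] q_ge_1 by (simp add: inverse_eq_divide)

lemma deriv_G:
  assumes "T < t"
  shows "(G has_real_derivative 1 - g t * g2 t / (g1 t)\<^sup>2) (at t)"
  unfolding G_def
  by (rule derivative_eq_intros deriv_g deriv_g1 assms)+
     (use g1_pos[OF assms] in \<open>auto simp: field_simps power2_eq_square\<close>)

text \<open>L'Hospital's rule: \<open>G' = 1 - g g2 / g1^2\<close> tends to \<open>1 - 1/q\<close>.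
  For \<open>q = 1\<close> this says that \<open>G t\<close> is of smaller order than
  \<open>t\<close>.\<close>

lemma G_over_id: "((\<lambda>t. G t / t) \<longlongrightarrow> 1 - 1 / q) at_top"
proof (rule lhospital_at_top_at_top)
  show "\<forall>\<^sub>F t in at_top. (G has_real_derivative 1 - g t * g2 t / (g1 t)\<^sup>2) (at t)"
    using eventually_gt_at_top[of T] by eventually_elim (rule deriv_G)
  show "((\<lambda>t. (1 - g t * g2 t / (g1 t)\<^sup>2) / 1) \<longlongrightarrow> 1 - 1 / q) at_top"
    by (simp, intro tendsto_intros inverse_rate)
qed (auto intro: filterlim_ident)

text \<open>The comparison goes through \<open>ln g\<close>: l'Hospital applied to
  \<open>ln g1 / ln g\<close> again produces the quotient \<open>g g2 / g1^2\<close>, so this ratio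
  stays bounded, while \<open>ln g / g\<close> tends to zero.\<close>

lemma ln_g1_over_g: "((\<lambda>t. ln (g1 t) / g t) \<longlongrightarrow> 0) at_top"
proof -
  have "((\<lambda>t. ln (g1 t) / ln (g t)) \<longlongrightarrow> 1 / q) at_top"
  proof (rule lhospital_at_top_at_top)
    show "filterlim (\<lambda>t. ln (g t)) at_top at_top"
      by (rule filterlim_compose[OF ln_at_top g_at_top])
    show "\<forall>\<^sub>F t in at_top. g1 t / g t \<noteq> 0"
      using eventually_g_pos by eventually_elim (use g1_pos in force)
    show "\<forall>\<^sub>F t in at_top. ((\<lambda>t. ln (g1 t)) has_real_derivative g2 t / g1 t) (at t)"
      using eventually_gt_at_top[of T]
      by eventually_elim (auto intro!: derivative_eq_intros deriv_g1 g1_pos)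
    show "\<forall>\<^sub>F t in at_top. ((\<lambda>t. ln (g t)) has_real_derivative g1 t / g t) (at t)"
      using eventually_g_pos
      by eventually_elim (auto intro!: derivative_eq_intros deriv_g)
    show "((\<lambda>t. g2 t / g1 t / (g1 t / g t)) \<longlongrightarrow> 1 / q) at_top"
      by (rule Lim_transform_eventually[OF inverse_rate])
         (use eventually_g_pos in \<open>eventually_elim, auto simp: power2_eq_square\<close>)
  qed
  moreover have "((\<lambda>t. ln (g t) / g t) \<longlongrightarrow> 0) at_top"
    by (rule filterlim_compose[OF ln_x_over_x_tendsto_0 g_at_top])
  ultimately have "((\<lambda>t. ln (g1 t) / ln (g t) * (ln (g t) / g t)) \<longlongrightarrow> 1 / q * 0) at_top"
    by (rule tendsto_mult)
  \<comment> \<open>Beyond \<open>g t > 1\<close> the factor \<open>ln (g t)\<close> is nonzero and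
    cancels.\<close>
  moreover have "\<forall>\<^sub>F t in at_top. ln (g1 t) / ln (g t) * (ln (g t) / g t) = ln (g1 t) / g t"
    using filterlim_at_top_dense[THEN iffD1, OF g_at_top, rule_format, of 1]
    by eventually_elim auto
  ultimately show ?thesis by (auto elim: Lim_transform_eventually)
qed

lemma id_over_G:
  assumes "1 < q"
  shows "((\<lambda>t. t / G t) \<longlongrightarrow> conj_exponent q) at_top"
proof -
  have "((\<lambda>t. inverse (G t / t)) \<longlongrightarrow> inverse (1 - 1 / q)) at_top"
    using assms by (intro tendsto_inverse G_over_id) auto
  then show ?thesis using assms by (simp add: conj_exponent_def field_simps)
qed

section \<open>Change of \<open>g\<close> and \<open>G\<close> between comparable arguments\<close>

text \<open>With respect to \<open>ln t\<close>, the function \<open>ln g\<close> has slope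
  \<open>t / G t\<close>, which tends to the conjugate exponent. Cauchy's mean value theorem for
  \<open>ln g\<close> against \<open>ln\<close> turns this into a power law.\<close>

lemma regularly_varying:
  assumes "1 < q" and X: "filterlim X at_top F"
    and Y: "((\<lambda>n. Y n / X n) \<longlongrightarrow> c) F" "0 < c"
  shows "((\<lambda>n. g (Y n) / g (X n)) \<longlongrightarrow> c powr conj_exponent q) F"
proof -
  define p where "p = conj_exponent q"
  obtain S where S: "T < S" "\<And>t. S \<le> t \<Longrightarrow> 0 < g t" using threshold by blast
  have elast: "((\<lambda>t. t / G t) \<longlongrightarrow> p) at_top"
    using id_over_G[OF \<open>1 < q\<close>] by (simp add: p_def)
  \<comment> \<open>Beyond \<open>S\<close> the function \<open>g\<close> is positive and
    \<open>ln g\<close> differentiable; beyond \<open>1\<close> the same holds for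
    \<open>ln\<close>.\<close>
  have X_pos: "\<forall>\<^sub>F n in F. max S 1 < X n"
    using X unfolding filterlim_at_top_dense by blast
  have "filterlim (\<lambda>n. Y n / X n * X n) at_top F"
    by (rule filterlim_tendsto_pos_mult_at_top[OF Y X])
  then have Y_lim: "filterlim Y at_top F"
    by (rule filterlim_cong[THEN iffD1, rotated -1]) (use X_pos in \<open>auto elim!: eventually_mono\<close>)
  then have Y_pos: "\<forall>\<^sub>F n in F. max S 1 < Y n" unfolding filterlim_at_top_dense by blast
  have "\<exists>\<xi>. min (X n) (Y n) \<le> \<xi> \<and> \<xi> \<le> max (X n) (Y n) \<and>
      ln (g (Y n)) - ln (g (X n)) = \<xi> / G \<xi> * (ln (Y n) - ln (X n))"
    if "max S 1 < X n" "max S 1 < Y n" for n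
  proof (cases "X n = Y n")
    case False
    have "\<exists>\<xi>. min (X n) (Y n) < \<xi> \<and> \<xi> < max (X n) (Y n) \<and>
      (ln (g (Y n)) - ln (g (X n))) * (1 / \<xi>) = (ln (Y n) - ln (X n)) * (g1 \<xi> / g \<xi>)"
    proof (rule cauchy_mvt[OF False])
      fix x assume x: "min (X n) (Y n) \<le> x" "x \<le> max (X n) (Y n)"
      then have x': "S < x" "1 < x" using that by (auto simp: min_def split: if_splits)
      show "((\<lambda>t. ln (g t)) has_real_derivative g1 x / g x) (at x)"
        using x' S by (auto intro!: derivative_eq_intros deriv_g)
      show "(ln has_real_derivative 1 / x) (at x)"
        using x' by (auto intro!: derivative_eq_intros)
    qed
    then obtain \<xi> where \<xi>: "min (X n) (Y n) < \<xi>" "\<xi> < max (X n) (Y n)"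
      "(ln (g (Y n)) - ln (g (X n))) * (1 / \<xi>) = (ln (Y n) - ln (X n)) * (g1 \<xi> / g \<xi>)"
      by blast
    then have "1 < \<xi>" using that by (auto simp: min_def split: if_splits)
    with \<xi>(3) have "ln (g (Y n)) - ln (g (X n)) = \<xi> / G \<xi> * (ln (Y n) - ln (X n))"
      by (simp add: G_def field_simps)
    with \<xi> show ?thesis by (intro exI[of _ \<xi>]) auto
  qed auto
  then obtain \<xi> where \<xi>: "\<And>n. max S 1 < X n \<Longrightarrow> max S 1 < Y n \<Longrightarrow>
      min (X n) (Y n) \<le> \<xi> n \<and> \<xi> n \<le> max (X n) (Y n) \<and>
      ln (g (Y n)) - ln (g (X n)) = \<xi> n / G (\<xi> n) * (ln (Y n) - ln (X n))"
    by metis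
  have "filterlim \<xi> at_top F"
    unfolding filterlim_at_top_dense
  proof
    fix Z
    have "\<forall>\<^sub>F n in F. Z < X n" "\<forall>\<^sub>F n in F. Z < Y n"
      using X Y_lim by (auto simp: filterlim_at_top_dense)
    then show "\<forall>\<^sub>F n in F. Z < \<xi> n"
      using X_pos Y_pos
    proof eventually_elim
      case (elim n)
      with \<xi>[of n] show ?case by linarith
    qed
  qed
  \<comment> \<open>As \<open>\<xi> n\<close> lies between \<open>X n\<close> and
    \<open>Y n\<close>, it tends to infinity too, and the slope there has its limit value.\<close>
  then have "((\<lambda>n. \<xi> n / G (\<xi> n) * ln (Y n / X n)) \<longlongrightarrow> p * ln c) F"
    using Y by (intro tendsto_mult filterlim_compose[OF elast] tendsto_ln) auto
  then have "((\<lambda>n. exp (\<xi> n / G (\<xi> n) * ln (Y n / X n))) \<longlongrightarrow> exp (p * ln c)) F"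
    by (rule tendsto_exp)
  moreover have "\<forall>\<^sub>F n in F. exp (\<xi> n / G (\<xi> n) * ln (Y n / X n)) = g (Y n) / g (X n)"
    using X_pos Y_pos
  proof eventually_elim
    case (elim n)
    then have "\<xi> n / G (\<xi> n) * ln (Y n / X n) = ln (g (Y n)) - ln (g (X n))"
      using \<xi>[of n] by (simp add: ln_div)
    then show ?case using elim S by (simp add: exp_diff)
  qed
  ultimately show ?thesis
    using Y by (auto simp: powr_def p_def mult.commute elim: Lim_transform_eventually)
qed

text \<open>For \<open>q = 1\<close> the derivative of \<open>G\<close> tends to zero, so
  \<open>G\<close> changes by only \<open>o(G X)\<close> over a window of length
  \<open>C * G X\<close>. The window escapes to infinity because \<open>G t\<close> is of smaller
  order than \<open>t\<close>.\<close>

lemma G_flat: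
  assumes "q = 1" and X: "filterlim X at_top F"
    and Y: "\<forall>\<^sub>F n in F. X n - C * G (X n) \<le> Y n \<and> Y n \<le> X n"
  shows "filterlim Y at_top F" "((\<lambda>n. G (Y n) / G (X n)) \<longlongrightarrow> 1) F"
proof -
  obtain S where S: "T < S" "\<And>t. S \<le> t \<Longrightarrow> 0 < g t" using threshold by blast
  have G_pos: "0 < G t" if "S \<le> t" for t
    using that S g1_pos[of t] by (simp add: G_def)
  have Xd: "\<forall>\<^sub>F n in F. Z < X n" for Z using X by (simp add: filterlim_at_top_dense)
  \<comment> \<open>The sign of \<open>C\<close> is not prescribed; the absolute value gives a bound
    for the window length in either case.\<close>
  define C' where "C' = \<bar>C\<bar>"
  have "((\<lambda>t. 1 - C' * (G t / t)) \<longlongrightarrow> 1 - C' * (1 - 1 / q)) at_top"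
    by (intro tendsto_intros G_over_id)
  then have "((\<lambda>t. 1 - C' * (G t / t)) \<longlongrightarrow> 1) at_top" using assms(1) by simp
  from filterlim_compose[OF this X]
  have "filterlim (\<lambda>n. (1 - C' * (G (X n) / X n)) * X n) at_top F"
    by (rule filterlim_tendsto_pos_mult_at_top[OF _ _ X]) simp
  then show lim: "filterlim Y at_top F"
  proof (rule filterlim_at_top_mono)
    show "\<forall>\<^sub>F n in F. (1 - C' * (G (X n) / X n)) * X n \<le> Y n"
      using Y Xd[of S] Xd[of 0]
    proof eventually_elim
      case (elim n)
      have "C * G (X n) \<le> C' * G (X n)"
        using G_pos[of "X n"] elim by (intro mult_right_mono) (auto simp: C'_def)
      moreover have "(1 - C' * (G (X n) / X n)) * X n = X n - C' * G (X n)"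
        using elim by (simp add: field_simps)
      ultimately show ?case using elim by linarith
    qed
  qed
  define D where "D = (\<lambda>t. 1 - g t * g2 t / (g1 t)\<^sup>2)"
  have "(D \<longlongrightarrow> 1 - 1 / q) at_top" unfolding D_def by (intro tendsto_intros inverse_rate)
  then have D_lim: "(D \<longlongrightarrow> 0) at_top" using assms(1) by simp
  have "((\<lambda>n. G (Y n) / G (X n) - 1) \<longlongrightarrow> 0) F"
  proof (rule tendstoI)
    fix e :: real assume "0 < e"
    \<comment> \<open>Adding \<open>1\<close> avoids a zero denominator and makes
      \<open>e' * C' < e\<close> strict.\<close>
    define e' where "e' = e / (C' + 1)"
    have e': "0 < e'" "e' * C' < e"
      using \<open>0 < e\<close> by (auto simp: e'_def C'_def field_simps)
    obtain Z where Z: "\<And>t. Z \<le> t \<Longrightarrow> \<bar>D t\<bar> < e'"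
      using tendstoD[OF D_lim e'(1)] by (auto simp: eventually_at_top_linorder dist_real_def)
    have "\<forall>\<^sub>F n in F. max S Z < Y n" using lim unfolding filterlim_at_top_dense by blast
    then show "\<forall>\<^sub>F n in F. dist (G (Y n) / G (X n) - 1) 0 < e"
      using Y Xd[of S]
    proof eventually_elim
      case (elim n)
      have XY: "\<bar>X n - Y n\<bar> \<le> C' * G (X n)"
      proof -
        have "C * G (X n) \<le> C' * G (X n)"
          using G_pos[of "X n"] elim by (intro mult_right_mono) (auto simp: C'_def)
        then show ?thesis using elim by auto
      qed
      have "\<bar>G (X n) - G (Y n)\<bar> \<le> e' * \<bar>X n - Y n\<bar>"
      proof (cases "Y n = X n")
        case False
        then have "Y n < X n" using elim by auto
        then have "\<exists>z. Y n < z \<and> z < X n \<and> G (X n) - G (Y n) = (X n - Y n) * D z"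
          using elim S unfolding D_def by (intro MVT2 deriv_G) auto
        then obtain z where z: "Y n < z" "G (X n) - G (Y n) = (X n - Y n) * D z" by blast
        then show ?thesis
          using Z[of z] elim by (auto simp: abs_mult mult.commute intro!: mult_right_mono)
      qed auto
      also have "\<dots> \<le> e' * (C' * G (X n))" using XY e' by (intro mult_left_mono) auto
      also have "\<dots> < e * G (X n)"
        using e' G_pos[of "X n"] elim by (simp flip: mult.assoc)
      finally show ?case
        using G_pos[of "X n"] elim by (simp add: dist_real_def field_simps abs_minus_commute)
    qed
  qed
  then show "((\<lambda>n. G (Y n) / G (X n)) \<longlongrightarrow> 1) F"
    by (simp add: LIM_zero_iff)
qed

text \<open>The slope of \<open>ln g\<close> is \<open>1 / G\<close>, and by \<open>G_flat\<close>
  this is constant up to a factor \<open>1 + o(1)\<close> between \<open>Y\<close> and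
  \<open>X\<close>; hence \<open>ln g\<close> drops by \<open>c + o(1)\<close>.\<close>

lemma exponential_window:
  assumes "q = 1" and X: "filterlim X at_top F"
    and le: "\<forall>\<^sub>F n in F. Y n \<le> X n"
    and Y: "((\<lambda>n. (X n - Y n) / G (X n)) \<longlongrightarrow> c) F"
  shows "((\<lambda>n. g (Y n) / g (X n)) \<longlongrightarrow> exp (- c)) F"
proof -
  obtain S where S: "T < S" "\<And>t. S \<le> t \<Longrightarrow> 0 < g t" using threshold by blast
  have G_pos: "0 < G t" if "S \<le> t" for t
    using that S g1_pos[of t] by (simp add: G_def)
  have Xd: "\<forall>\<^sub>F n in F. Z < X n" for Z using X by (simp add: filterlim_at_top_dense)
  have "\<forall>\<^sub>F n in F. (X n - Y n) / G (X n) < c + 1"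
    using Y by (rule order_tendstoD) simp
  with le Xd[of S] have win: "\<forall>\<^sub>F n in F. X n - (c + 1) * G (X n) \<le> Y n \<and> Y n \<le> X n"
  proof eventually_elim
    case (elim n)
    then show ?case using G_pos[of "X n"] by (auto simp: field_simps)
  qed
  note Y_lim = G_flat(1)[OF \<open>q = 1\<close> X win]
  have Yd: "\<forall>\<^sub>F n in F. S < Y n" using Y_lim by (simp add: filterlim_at_top_dense)
  have "\<exists>\<xi>. Y n \<le> \<xi> \<and> \<xi> \<le> X n \<and> ln (g (X n)) - ln (g (Y n)) = (X n - Y n) / G \<xi>"
    if "S < Y n" "Y n \<le> X n" for n
  proof (cases "Y n = X n")
    case False
    with that have "Y n < X n" by auto
    then have "\<exists>z. Y n < z \<and> z < X n \<and> ln (g (X n)) - ln (g (Y n)) = (X n - Y n) * (g1 z / g z)"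
      using that S by (intro MVT2) (auto intro!: derivative_eq_intros deriv_g)
    then obtain z where "Y n < z" "z < X n"
        "ln (g (X n)) - ln (g (Y n)) = (X n - Y n) * (g1 z / g z)" by blast
    then show ?thesis by (intro exI[of _ z]) (auto simp: G_def)
  qed auto
  then obtain \<xi> where \<xi>: "\<And>n. S < Y n \<Longrightarrow> Y n \<le> X n \<Longrightarrow>
      Y n \<le> \<xi> n \<and> \<xi> n \<le> X n \<and> ln (g (X n)) - ln (g (Y n)) = (X n - Y n) / G (\<xi> n)"
    by metis
  \<comment> \<open>The mean value point lies in the same window, so \<open>G_flat\<close> applies
    to it in place of \<open>Y\<close>.\<close>
  have "\<forall>\<^sub>F n in F. X n - (c + 1) * G (X n) \<le> \<xi> n \<and> \<xi> n \<le> X n"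
    using win Yd
  proof eventually_elim
    case (elim n)
    with \<xi>[of n] show ?case by linarith
  qed
  from G_flat(2)[OF \<open>q = 1\<close> X this]
  have "((\<lambda>n. exp (- ((X n - Y n) / G (X n) / (G (\<xi> n) / G (X n))))) \<longlongrightarrow> exp (- (c / 1))) F"
    by (intro tendsto_intros Y) auto
  moreover have "\<forall>\<^sub>F n in F. exp (- ((X n - Y n) / G (X n) / (G (\<xi> n) / G (X n)))) = g (Y n) / g (X n)"
    using Yd le
  proof eventually_elim
    case (elim n)
    then have "(X n - Y n) / G (X n) / (G (\<xi> n) / G (X n)) = ln (g (X n)) - ln (g (Y n))"
      using \<xi>[of n] G_pos[of "X n"] by simp
    then show ?case using elim S by (simp add: exp_diff)
  qed
  ultimately show ?thesis by (auto elim: Lim_transform_eventually)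
qed

text \<open>In both cases the position of \<open>Y\<close> relative to \<open>X\<close> is measured by the limit of
  \<open>(X - Y) / G(X)\<close>; for \<open>q > 1\<close> this just encodes the limit of \<open>Y / X\<close>.\<close>

definition decay :: "real \<Rightarrow> real" where
  "decay c = (if q > 1 then 1 - c / conj_exponent q else 1)"

text \<open>The limit of \<open>g Y / g X\<close> at level \<open>c\<close>, as
  \<open>decay c\<close> is that of \<open>G Y / G X\<close>. The exponential is the limit of the
  power expression when the conjugate exponent tends to infinity.\<close>

definition height :: "real \<Rightarrow> real" where
  "height c = (if q > 1 then (1 - c / conj_exponent q) powr conj_exponent q else exp (- c))"

text \<open>Write \<open>Y / X\<close> as \<open>1 - (X - Y) / G X * (G X / X)\<close>; the last
  factor tends to the reciprocal of the conjugate exponent.\<close>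

lemma ratio_of_level:
  assumes "1 < q" and X: "filterlim X at_top F"
    and Y: "((\<lambda>n. (X n - Y n) / G (X n)) \<longlongrightarrow> c) F"
  shows "((\<lambda>n. Y n / X n) \<longlongrightarrow> 1 - c / conj_exponent q) F"
proof -
  have ne: "1 - 1 / q = 1 / conj_exponent q"
    using assms(1) by (simp add: conj_exponent_def field_simps)
  have "((\<lambda>n. 1 - (X n - Y n) / G (X n) * (G (X n) / X n)) \<longlongrightarrow> 1 - c * (1 - 1 / q)) F"
    by (intro tendsto_intros Y filterlim_compose[OF G_over_id X])
  moreover have "\<forall>\<^sub>F n in F. 1 - (X n - Y n) / G (X n) * (G (X n) / X n) = Y n / X n"
    using eventually_G_pos[OF X] filterlim_at_top_dense[THEN iffD1, OF X, rule_format, of 0]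
    by eventually_elim (simp, simp add: diff_divide_distrib)
  ultimately show ?thesis by (auto simp: ne elim: Lim_transform_eventually)
qed

lemma level_of_ratio:
  assumes "1 < q" and X: "filterlim X at_top F" and Y: "((\<lambda>n. Y n / X n) \<longlongrightarrow> d) F"
  shows "((\<lambda>n. (X n - Y n) / G (X n)) \<longlongrightarrow> conj_exponent q * (1 - d)) F"
proof -
  have "((\<lambda>n. X n / G (X n) * (1 - Y n / X n)) \<longlongrightarrow> conj_exponent q * (1 - d)) F"
    by (intro tendsto_intros Y filterlim_compose[OF id_over_G X] assms(1))
  moreover have "\<forall>\<^sub>F n in F. X n / G (X n) * (1 - Y n / X n) = (X n - Y n) / G (X n)"
    using filterlim_at_top_dense[THEN iffD1, OF X, rule_format, of 0]
    by eventually_elim (simp add: right_diff_distrib diff_divide_distrib)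
  ultimately show ?thesis by (rule Lim_transform_eventually)
qed

text \<open>For \<open>q > 1\<close> the bound on \<open>c\<close> makes the limit of
  \<open>Y / X\<close> positive, so \<open>Y\<close> still tends to infinity; as \<open>G t\<close>
  is asymptotically proportional to \<open>t\<close>, the ratio of the \<open>G\<close> values has
  the same limit as \<open>Y / X\<close>. For \<open>q = 1\<close> the claims are
  \<open>G_flat\<close> and \<open>exponential_window\<close>.\<close>

lemma level:
  assumes X: "filterlim X at_top F"
    and le: "\<forall>\<^sub>F n in F. Y n \<le> X n"
    and Y: "((\<lambda>n. (X n - Y n) / G (X n)) \<longlongrightarrow> c) F"
    and c: "1 < q \<Longrightarrow> c < conj_exponent q"
  shows "0 < decay c" "0 < height c" "filterlim Y at_top F"
    "((\<lambda>n. G (Y n) / G (X n)) \<longlongrightarrow> decay c) F" "((\<lambda>n. g (Y n) / g (X n)) \<longlongrightarrow> height c) F"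
proof -
  have "0 < decay c \<and> 0 < height c \<and> filterlim Y at_top F \<and>
    ((\<lambda>n. G (Y n) / G (X n)) \<longlongrightarrow> decay c) F \<and> ((\<lambda>n. g (Y n) / g (X n)) \<longlongrightarrow> height c) F"
  proof (cases "1 < q")
    case True
    have p: "0 < conj_exponent q" using True by (simp add: conj_exponent_def)
    have pos: "0 < 1 - c / conj_exponent q" using c[OF True] p by simp
    note ratio = ratio_of_level[OF True X Y]
    have Xpos: "\<forall>\<^sub>F n in F. 0 < X n" using X unfolding filterlim_at_top_dense by blast
    have "filterlim (\<lambda>n. Y n / X n * X n) at_top F"
      by (rule filterlim_tendsto_pos_mult_at_top[OF ratio pos X])
    then have Y_lim: "filterlim Y at_top F"
      by (rule filterlim_cong[THEN iffD1, rotated -1]) (use Xpos in \<open>auto elim!: eventually_mono\<close>)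
    then have Ypos: "\<forall>\<^sub>F n in F. 0 < Y n" unfolding filterlim_at_top_dense by blast
    have "((\<lambda>n. G (Y n) / Y n * (Y n / X n) * (X n / G (X n))) \<longlongrightarrow>
        (1 - 1 / q) * (1 - c / conj_exponent q) * conj_exponent q) F"
      by (intro tendsto_intros ratio filterlim_compose[OF id_over_G[OF True] X]
          filterlim_compose[OF G_over_id Y_lim])
    moreover have "(1 - 1 / q) * (1 - c / conj_exponent q) * conj_exponent q = 1 - c / conj_exponent q"
    proof -
      have "(1 - 1 / q) * conj_exponent q = 1"
        using True by (simp add: conj_exponent_def field_simps)
      then show ?thesis by (metis mult.commute mult.left_commute mult.right_neutral)
    qed
    ultimately have "((\<lambda>n. G (Y n) / Y n * (Y n / X n) * (X n / G (X n))) \<longlongrightarrow> 1 - c / conj_exponent q) F"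
      by simp
    moreover have "\<forall>\<^sub>F n in F. G (Y n) / Y n * (Y n / X n) * (X n / G (X n)) = G (Y n) / G (X n)"
      using Xpos Ypos by eventually_elim auto
    ultimately have "((\<lambda>n. G (Y n) / G (X n)) \<longlongrightarrow> 1 - c / conj_exponent q) F"
      by (rule Lim_transform_eventually)
    then show ?thesis
      unfolding decay_def height_def
      using pos True Y_lim regularly_varying[OF True X ratio pos] by (simp del: right_minus_eq)
  next
    case False
    with q_ge_1 have "q = 1" by simp
    have "\<forall>\<^sub>F n in F. (X n - Y n) / G (X n) < c + 1"
      using Y by (rule order_tendstoD) simp
    with eventually_G_pos[OF X] le have "\<forall>\<^sub>F n in F. X n - (c + 1) * G (X n) \<le> Y n \<and> Y n \<le> X n"
      by eventually_elim (auto simp: field_simps)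
    from G_flat[OF \<open>q = 1\<close> X this] exponential_window[OF \<open>q = 1\<close> X le Y] show ?thesis
      unfolding decay_def height_def using False by simp
  qed
  then show "0 < decay c" "0 < height c" "filterlim Y at_top F"
    "((\<lambda>n. G (Y n) / G (X n)) \<longlongrightarrow> decay c) F" "((\<lambda>n. g (Y n) / g (X n)) \<longlongrightarrow> height c) F"
    by auto
qed

end

section \<open>Derivatives within a set, the logarithm of \<open>f\<close>, and relative
  asymptotics\<close>

lemma wderiv_eq:
  assumes "x \<in> interior S" "(\<phi> has_real_derivative D) (at x)"
  shows "wderiv S \<phi> x = D"
  unfolding wderiv_def at_within_interior[OF assms(1)]
  using assms(2) unfolding has_real_derivative_iff_has_vector_derivative
  by (rule vector_derivative_at)

lemma wderiv_works:
  assumes "x \<in> interior S" "\<phi> differentiable_on S"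
  shows "(\<phi> has_real_derivative wderiv S \<phi> x) (at x)"
proof -
  have "\<phi> differentiable (at x within S)"
    using assms interior_subset by (auto simp: differentiable_on_def)
  then show ?thesis
    unfolding wderiv_def at_within_interior[OF assms(1)] vector_derivative_works
      has_real_derivative_iff_has_vector_derivative .
qed

text \<open>At \<open>t > t0\<close> derivatives within \<open>{t0..}\<close> and within
  \<open>{0..}\<close> are the ordinary ones, so both assign \<open>f\<close> the same derivative
  and \<open>g1 = f' / f\<close>. This quotient is differentiable because \<open>f\<close> is of
  class \<open>C^2\<close> there.\<close>

lemma log_of_growth:
  assumes t0: "0 \<le> t0" "\<And>t. t0 \<le> t \<Longrightarrow> 0 < f t" "C2_on {t0..} f"
    and t: "t0 < t"
  defines "g \<equiv> log_of f"
  defines "g1 \<equiv> wderiv {t0..} g"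
  defines "g2 \<equiv> wderiv {t0..} g1"
  shows "(g has_real_derivative g1 t) (at t)" "(g1 has_real_derivative g2 t) (at t)"
    "wderiv {0..} f t = f t * g1 t"
proof -
  have int: "s \<in> interior {t0..}" if "t0 < s" for s using that by simp
  have f1: "(f has_real_derivative wderiv {t0..} f s) (at s)" if "t0 < s" for s
    using t0(3) by (intro wderiv_works int that) (simp add: C2_on_def C1_on_def)
  have f2: "(wderiv {t0..} f has_real_derivative wderiv {t0..} (wderiv {t0..} f) t) (at t)"
    using t0(3) by (intro wderiv_works int t) (simp add: C2_on_def C1_on_def)
  have g: "(g has_real_derivative wderiv {t0..} f s / f s) (at s)" if "t0 < s" for s
    unfolding g_def log_of_def using f1[OF that] t0(2)[of s] that
    by (auto intro!: derivative_eq_intros)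
  then have g1: "g1 s = wderiv {t0..} f s / f s" if "t0 < s" for s
    unfolding g1_def using that by (intro wderiv_eq int)
  show "(g has_real_derivative g1 t) (at t)" using g t by (simp add: g1)
  have "\<exists>D. ((\<lambda>s. wderiv {t0..} f s / f s) has_real_derivative D) (at t)"
    using DERIV_divide[OF f2 f1[OF t]] t0(2)[of t] t by force
  then obtain D where "((\<lambda>s. wderiv {t0..} f s / f s) has_real_derivative D) (at t)" by blast
  then have "(g1 has_real_derivative D) (at t)"
    \<comment> \<open>The formula for \<open>g1\<close> is known on the open half-line only, which
      is a neighbourhood of \<open>t\<close>.\<close>
    by (rule has_field_derivative_transform_within_open[of _ _ _ "{t0<..}"]) (use t g1 in auto)
  moreover from this have "g2 t = D" unfolding g2_def by (intro wderiv_eq int t)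
  ultimately show "(g1 has_real_derivative g2 t) (at t)" by simp
  have "wderiv {0..} f t = wderiv {t0..} f t"
    using t0(1) t by (intro wderiv_eq f1) auto
  then show "wderiv {0..} f t = f t * g1 t" using t0(2)[of t] t by (simp add: g1)
qed

text \<open>Both sides are compared with a common normalisation \<open>Z\<close>, later
  \<open>g\<close> at the concentration centre.\<close>

lemma asymp_factorI:
  assumes X: "((\<lambda>n. X n / Z n) \<longlonglongrightarrow> c * d)" and Y: "((\<lambda>n. Y n / Z n) \<longlonglongrightarrow> d)"
    and "d \<noteq> 0"
  shows "asymp_factor X c Y"
proof -
  have "(\<lambda>n. X n / Z n / (Y n / Z n) - c) \<longlonglongrightarrow> c * d / d - c"
    by (intro tendsto_intros assms)
  \<comment> \<open>Division by zero yields zero, so a nonzero quotient excludes both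
    \<open>Y n = 0\<close> and \<open>Z n = 0\<close>.\<close>
  moreover have "\<forall>\<^sub>F n in sequentially. Y n / Z n \<noteq> 0"
    using tendsto_imp_eventually_ne[OF Y \<open>d \<noteq> 0\<close>] .
  then have "\<forall>\<^sub>F n in sequentially. X n = (c + (X n / Z n / (Y n / Z n) - c)) * Y n"
    by eventually_elim auto
  ultimately show ?thesis
    using \<open>d \<noteq> 0\<close> unfolding asymp_factor_def by (intro exI conjI) auto
qed

section \<open>The flux of a radial solution\<close>

locale radial_solution =
  fixes h f u :: "real \<Rightarrow> real" and lam :: real
  assumes C2: "C2_on {0..1} u"
    and ode: "x \<in> {0<..<1} \<Longrightarrow>
      - wderiv {0..1} (wderiv {0..1} u) x - 1 / x * wderiv {0..1} u x = lam * h x * f (u x)"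
    and source_nonneg: "x \<in> {0<..<1} \<Longrightarrow> 0 \<le> lam * h x * f (u x)"
begin

text \<open>Up to the factor \<open>2 pi\<close>, the flux of the negative gradient of the radial
  solution through the circle of radius \<open>x\<close>. It equals the derivative of
  \<open>- u\<close> with respect to \<open>ln x\<close>.\<close>

definition flux :: "real \<Rightarrow> real" where
  "flux x = - (x * wderiv {0..1} u x)"

lemma deriv_u:
  assumes "0 < x" "x < 1"
  shows "(u has_real_derivative - flux x / x) (at x)"
  using wderiv_works[of x "{0..1}" u] C2 assms by (simp add: flux_def C2_on_def C1_on_def)

lemma continuous_u: "continuous_on {0..1} u"
  using C2 by (simp add: C2_on_def C1_on_def differentiable_imp_continuous_on)

lemma continuous_flux: "continuous_on {0..1} flux"
  unfolding flux_def using C2 by (intro continuous_intros) (simp add: C2_on_def C1_on_def)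

text \<open>Multiplying the equation by \<open>x\<close> puts the radial Laplacian into divergence
  form: \<open>x u'' + u' = (x u')'\<close>.\<close>

lemma deriv_flux:
  assumes "0 < x" "x < 1"
  shows "(flux has_real_derivative lam * h x * f (u x) * x) (at x)"
proof -
  have "(wderiv {0..1} u has_real_derivative wderiv {0..1} (wderiv {0..1} u) x) (at x)"
    using wderiv_works[of x "{0..1}" "wderiv {0..1} u"] C2 assms
    by (simp add: C2_on_def C1_on_def)
  then have "(flux has_real_derivative
      - (wderiv {0..1} u x + x * wderiv {0..1} (wderiv {0..1} u) x)) (at x)"
    unfolding flux_def by (auto intro!: derivative_eq_intros)
  moreover have "- (wderiv {0..1} u x + x * wderiv {0..1} (wderiv {0..1} u) x)
      = lam * h x * f (u x) * x"
  proof -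
    have "lam * h x * f (u x) * x
        = (- wderiv {0..1} (wderiv {0..1} u) x - 1 / x * wderiv {0..1} u x) * x"
      using assms by (subst ode) auto
    then show ?thesis using assms by (simp add: algebra_simps)
  qed
  ultimately show ?thesis by simp
qed

lemma integral_source:
  assumes "0 \<le> a" "a \<le> b" "b \<le> 1"
  shows "integral {a..b} (\<lambda>x. lam * h x * f (u x) * x) = flux b - flux a"
\<comment> \<open>The equation is given on the open interval only; continuity of the flux up to the
  end points covers the rest.\<close>
proof (rule integral_unique, rule fundamental_theorem_of_calculus_interior)
  show "continuous_on {a..b} flux"
    by (rule continuous_on_subset[OF continuous_flux]) (use assms in auto)
  show "(flux has_vector_derivative lam * h x * f (u x) * x) (at x)" if "x \<in> {a<..<b}" for x
    using deriv_flux[of x] that assms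
    unfolding has_real_derivative_iff_has_vector_derivative by auto
qed (use assms in auto)

lemma flux_mono:
  assumes "0 \<le> a" "a \<le> b" "b \<le> 1"
  shows "flux a \<le> flux b"
proof (rule DERIV_nonneg_imp_increasing_open[of a b flux])
  show "\<exists>y. (flux has_real_derivative y) (at x) \<and> 0 \<le> y" if "a < x" "x < b" for x
    using that assms deriv_flux[of x] source_nonneg[of x]
    by (intro exI[of _ "lam * h x * f (u x) * x"]) auto
  show "continuous_on {a..b} flux"
    by (rule continuous_on_subset[OF continuous_flux]) (use assms in auto)
qed (use assms in auto)

lemma flux_nonneg: "0 \<le> x \<Longrightarrow> x \<le> 1 \<Longrightarrow> 0 \<le> flux x"
  using flux_mono[of 0 x] by (simp add: flux_def)

lemma u_antimono:
  assumes "0 \<le> a" "a \<le> b" "b \<le> 1"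
  shows "u b \<le> u a"
proof (rule DERIV_nonpos_imp_decreasing_open[of a b u])
  show "\<exists>y. (u has_real_derivative y) (at x) \<and> y \<le> 0" if "a < x" "x < b" for x
    using that assms deriv_u[of x] flux_nonneg[of x]
    by (intro exI[of _ "- flux x / x"]) auto
  show "continuous_on {a..b} u"
    by (rule continuous_on_subset[OF continuous_u]) (use assms in auto)
qed (rule assms)

text \<open>Cauchy's mean value theorem for \<open>u\<close> against \<open>ln\<close>. Where the
  flux is nearly constant, \<open>u\<close> is therefore nearly linear in
  \<open>ln x\<close>.\<close>

lemma drop_between:
  assumes "0 < a" "a < b" "b < 1"
  obtains \<xi> where "a < \<xi>" "\<xi> < b" "u a - u b = flux \<xi> * ln (b / a)"
proof -
  have "\<exists>\<xi>. a < \<xi> \<and> \<xi> < b \<and> (u b - u a) * (1 / \<xi>) = (ln b - ln a) * (- flux \<xi> / \<xi>)"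
  proof (rule GMVT')
    show "isCont u z" if "a \<le> z" "z \<le> b" for z
      by (rule DERIV_isCont[OF deriv_u]) (use that assms in auto)
    show "isCont ln z" if "a \<le> z" "z \<le> b" for z
      by (rule DERIV_isCont[OF DERIV_ln_divide]) (use that assms in auto)
    show "(ln has_real_derivative 1 / z) (at z)" if "a < z" "z < b" for z
      by (rule DERIV_ln_divide) (use that assms in auto)
    show "(u has_real_derivative - flux z / z) (at z)" if "a < z" "z < b" for z
      by (rule deriv_u) (use that assms in auto)
  qed (rule assms)
  then obtain \<xi> where \<xi>: "a < \<xi>" "\<xi> < b"
    "(u b - u a) * (1 / \<xi>) = (ln b - ln a) * (- flux \<xi> / \<xi>)" by blast
  show thesis
  proof (rule that)
    show "u a - u b = flux \<xi> * ln (b / a)"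
    proof -
      have "\<xi> \<noteq> 0" using \<xi> assms by simp
      then have "u b - u a = (ln b - ln a) * - flux \<xi>"
        using \<xi>(3) by (simp add: divide_simps split: if_splits)
      then show ?thesis using assms by (simp add: ln_div algebra_simps)
    qed
  qed (use \<xi> in auto)
qed

text \<open>The operator \<open>x d/dx\<close> commutes with dilations, so rescaling the radius
  leaves the flux unchanged apart from the factor \<open>K\<close>.\<close>

lemma rescaled_flux:
  assumes "0 < c" "0 < x" "c * x < 1"
  shows "- (x * wderiv {0..1 / c} (\<lambda>x. K * (u (c * x) - m)) x) = K * flux (c * x)"
proof -
  have "((\<lambda>x. u (c * x)) has_real_derivative - flux (c * x) / (c * x) * c) (at x)"
    by (rule DERIV_chain2[OF deriv_u]) (use assms in \<open>auto intro!: derivative_eq_intros\<close>)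
  then have "((\<lambda>x. K * (u (c * x) - m)) has_real_derivative K * (- flux (c * x) / (c * x) * c)) (at x)"
    by (auto intro!: derivative_eq_intros)
  then have "wderiv {0..1 / c} (\<lambda>x. K * (u (c * x) - m)) x = K * (- flux (c * x) / (c * x) * c)"
    by (rule wderiv_eq[rotated]) (use assms in \<open>auto simp: field_simps\<close>)
  then show ?thesis using assms by simp
qed

end

section \<open>Limit profiles and constants\<close>

text \<open>The flux of the limit profile \<open>z_prof\<close>. Written with
  \<open>y / (1 + y)\<close>, it visibly increases from \<open>2 - a\<close> to
  \<open>2 + a\<close>.\<close>

definition profile_flux :: "real \<Rightarrow> nat \<Rightarrow> real \<Rightarrow> real" where
  "profile_flux q k x =
     (let a = a_const q k; y = b_const q k * x powr a in 2 - a + 2 * a * (y / (1 + y)))"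

lemma a_const_range:
  assumes "1 \<le> q" "q < 2" "k \<ge> 1"
  shows "0 < a_const q k" "a_const q k \<le> 2"
  using const_pair_range[OF assms] by (auto simp: a_const_def)

lemma z_prof_flux:
  assumes "1 \<le> q" "q < 2" "k \<ge> 1" "0 < x"
  shows "- (x * wderiv (z_dom k) (z_prof q k) x) = profile_flux q k x"
proof -
  define a where "a = a_const q k"
  define b where "b = b_const q k"
  have a: "0 < a" "a \<le> 2" using a_const_range assms by (auto simp: a_def)
  then have b: "0 < b" by (simp add: b_def b_const_def a_def)
  \<comment> \<open>For \<open>a = 2\<close> the coefficient of \<open>ln y\<close> vanishes, in
    agreement with the case distinction in \<open>z_prof\<close>.\<close>
  have z: "z_prof q k y = ln (2 * a\<^sup>2 * b) - ((2 - a) * ln y + 2 * ln (1 + b * y powr a))"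
    if "0 < y" for y
  proof -
    have "1 + b * y powr a > 0" using b by (simp add: add_pos_nonneg)
    then show ?thesis
      using that a b
      by (auto simp: z_prof_def Let_def ln_div ln_mult ln_powr ln_realpow simp flip: a_def b_def)
  qed
  have pos: "0 < 1 + b * x powr a" using b by (simp add: add_pos_nonneg)
  have "((\<lambda>y. ln (2 * a\<^sup>2 * b) - ((2 - a) * ln y + 2 * ln (1 + b * y powr a)))
      has_real_derivative 0 - ((2 - a) * (1 / x) + 2 * ((b * (a * x powr (a - 1))) / (1 + b * x powr a)))) (at x)"
    using assms pos by (auto intro!: derivative_eq_intros)
  moreover have "x powr (a - 1) = x powr a / x"
    using assms by (simp add: powr_diff)
  then have "0 - ((2 - a) * (1 / x) + 2 * ((b * (a * x powr (a - 1))) / (1 + b * x powr a)))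
      = - (profile_flux q k x / x)"
    using assms by (simp add: profile_flux_def Let_def add_divide_distrib diff_divide_distrib
        mult_ac flip: a_def b_def)
  ultimately have "((\<lambda>y. ln (2 * a\<^sup>2 * b) - ((2 - a) * ln y + 2 * ln (1 + b * y powr a)))
      has_real_derivative - (profile_flux q k x / x)) (at x)"
    by simp
  then have "(z_prof q k has_real_derivative - (profile_flux q k x / x)) (at x)"
    by (rule has_field_derivative_transform_within_open[of _ _ _ "{0<..}"])
       (use assms z in auto)
  \<comment> \<open>A point \<open>x > 0\<close> is interior to \<open>z_dom k\<close> whether or
    not this set contains \<open>0\<close>.\<close>
  then have "wderiv (z_dom k) (z_prof q k) x = - (profile_flux q k x / x)"
    by (rule wderiv_eq[rotated]) (use assms in \<open>auto simp: z_dom_def interior_open\<close>)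
  then show ?thesis using assms by simp
qed

lemma profile_flux_limits:
  assumes "1 \<le> q" "q < 2" "k \<ge> 1"
  shows "(profile_flux q k \<longlongrightarrow> 2 - a_const q k) (at_right 0)"
    and "(profile_flux q k \<longlongrightarrow> 2 + a_const q k) at_top"
proof -
  define a where "a = a_const q k"
  define b where "b = b_const q k"
  have a: "0 < a" using a_const_range assms by (auto simp: a_def)
  then have b: "0 < b" by (simp add: b_def b_const_def a_def)
  have eq: "profile_flux q k = (\<lambda>x. 2 - a + 2 * a * (b * x powr a / (1 + b * x powr a)))"
    by (auto simp: profile_flux_def Let_def a_def b_def)
  have "((\<lambda>x. x powr a) \<longlongrightarrow> 0) (at_right (0::real))"
    using a by (intro tendsto_eq_intros refl) (auto simp: eventually_at_filter)
  then have "(profile_flux q k \<longlongrightarrow> 2 - a + 2 * a * (b * 0 / (1 + b * 0))) (at_right 0)"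
    unfolding eq by (intro tendsto_intros) auto
  then show "(profile_flux q k \<longlongrightarrow> 2 - a_const q k) (at_right 0)" by (simp add: a_def)
  have "((\<lambda>x. x powr - a) \<longlongrightarrow> 0) (at_top :: real filter)"
    using a by (intro tendsto_neg_powr) (auto intro: filterlim_ident)
  \<comment> \<open>Numerator and denominator are divided by \<open>x powr a\<close>, so that each
    term converges at infinity.\<close>
  then have "((\<lambda>x. 2 - a + 2 * a * (b / (x powr - a + b))) \<longlongrightarrow> 2 - a + 2 * a * (b / (0 + b))) at_top"
    using b by (intro tendsto_intros) auto
  moreover have "\<forall>\<^sub>F x in at_top. 2 - a + 2 * a * (b / (x powr - a + b)) = profile_flux q k x"
    using eventually_gt_at_top[of 0]
  proof eventually_elim
    case (elim x)
    then have "x powr - a + b = (1 + b * x powr a) / x powr a"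
      by (simp add: powr_minus field_simps)
    then show ?case by (simp add: eq)
  qed
  ultimately have "(profile_flux q k \<longlongrightarrow> 2 - a + 2 * a * (b / (0 + b))) at_top"
    by (rule Lim_transform_eventually)
  then show "(profile_flux q k \<longlongrightarrow> 2 + a_const q k) at_top" using b by (simp add: a_def add.commute)
qed

text \<open>With \<open>y\<close> the ratio of consecutive \<open>\<delta>\<close>, positivity of
  the next \<open>a\<close> means \<open>y powr (p - 1) * (2 + a) < 2\<close>. Inserted into the
  equation defining \<open>y\<close>, this gives \<open>y < 1 - a / (2 * (p - 1))\<close>, the lower
  bound. The rest follows from \<open>0 < a \<le> 2 < 2 * (p - 1)\<close>.\<close>

lemma delta_star_between:
  assumes "1 < q" "q < 2" "k \<ge> 1"
  shows "0 < 1 - a_const q k / (2 * (conj_exponent q - 1))"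
    "delta_const q (k + 1) < delta_star q k" "delta_star q k < delta_const q k"
proof -
  define p where "p = conj_exponent q"
  define a where "a = a_const q k"
  define y where "y = delta_const q (k + 1) / delta_const q k"
  have p: "2 < p" using assms by (simp add: p_def conj_exponent_def field_simps)
  note c = conc_constants_gt1[OF assms, folded p_def a_def y_def]
  have y: "0 < y" using c conc_constants_gt1(3)[of q "k + 1"] assms by (simp add: y_def)
  have "y powr (p - 1) * (2 + a) < 2"
    using c(7) conc_constants_gt1(1)[of q "k + 1"] assms by simp
  then have "y * (y powr (p - 1) * (2 + a)) < y * 2" using y by simp
  then have "y powr p * (2 + a) < 2 * y" using y by (simp add: powr_diff)
  moreover have "2 * p * (1 - y) + (y powr p - 1) * (2 + a) = 0"
    using c(1,6) by (simp add: field_simps)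
  ultimately have "2 * (p - 1) * y < 2 * (p - 1) - a" by (simp add: algebra_simps)
  then have "y < 1 - a / (2 * (p - 1))" using p by (simp add: field_simps)
  then show "delta_const q (k + 1) < delta_star q k"
    using c(3) by (simp add: y_def delta_star_def p_def a_def field_simps)
  show "0 < 1 - a_const q k / (2 * (conj_exponent q - 1))"
    using p c(2) by (simp flip: p_def a_def add: field_simps)
  show "delta_star q k < delta_const q k"
    using p c(1,3) by (simp add: delta_star_def flip: p_def a_def)
qed

text \<open>The same argument for \<open>q = 1\<close>: positivity of the next \<open>a\<close>
  bounds \<open>y * (2 + a)\<close> by \<open>2\<close>, and the equation for \<open>y\<close> then
  yields \<open>ln y < - a / 2\<close>.\<close>

lemma eta_star_between:
  assumes "k \<ge> 1"
  shows "eta_const 1 (k + 1) < eta_star 1 k" "eta_star 1 k < eta_const 1 k"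
proof -
  define a where "a = a_const 1 k"
  define y where "y = eta_const 1 (k + 1) / eta_const 1 k"
  note c = conc_constants_eq1[OF assms, folded a_def y_def]
  have y: "0 < y" using c conc_constants_eq1(3)[of "k + 1"] by (simp add: y_def)
  have "y * (2 + a) < 2" using c(7) conc_constants_eq1(1)[of "k + 1"] by simp
  moreover have "2 * ln (1 / y) + (y - 1) * (2 + a) = 0"
    using c(1,6) by (simp add: y_def field_simps)
  ultimately have "ln y < - a / 2" using y by (simp add: ln_div algebra_simps)
  then have "y < exp (- a / 2)" using y by (metis exp_less_cancel_iff exp_ln)
  then show "eta_const 1 (k + 1) < eta_star 1 k"
    using c(3) by (simp add: y_def eta_star_def a_def field_simps)
  show "eta_star 1 k < eta_const 1 k"
    using c(1,3) by (simp add: eta_star_def flip: a_def)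
qed


text \<open>The limit of \<open>(\<mu> - u) / G \<mu>\<close> at the \<open>k\<close>-th bubble. For
  \<open>q > 1\<close> the ratio \<open>\<delta>\<close> is translated as in
  \<open>level_of_ratio\<close>; for \<open>q = 1\<close> the level is the coefficient in the peak
  expansion.\<close>

definition level_const :: "real \<Rightarrow> nat \<Rightarrow> real" where
  "level_const q k =
     (if q > 1 then conj_exponent q * (1 - delta_const q k) else ln (1 / eta_const q k))"

definition level_star :: "real \<Rightarrow> nat \<Rightarrow> real" where
  "level_star q k =
     (if q > 1 then conj_exponent q * (1 - delta_star q k) else ln (1 / eta_star q k))"

lemma level_const_range:
  assumes "1 \<le> q" "q < 2" "k \<ge> 1"
  shows "0 \<le> level_const q k" "1 < q \<Longrightarrow> level_const q k < conj_exponent q"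
proof -
  have "1 < q \<or> q = 1" using assms(1) by auto
  then show "0 \<le> level_const q k"
    using conc_constants_gt1(1-4)[of q k] conc_constants_eq1(3,4)[of k] assms
    by (auto simp: level_const_def conj_exponent_def)
  show "level_const q k < conj_exponent q" if "1 < q"
    using conc_constants_gt1(3)[of q k] assms that
    by (simp add: level_const_def conj_exponent_def field_simps)
qed

text \<open>Levels decrease in \<open>\<delta>\<close> and in \<open>\<eta>\<close>, which reverses
  the order. The strict inequalities leave room for the intermediate value theorem between two
  bubbles.\<close>

lemma level_star_between:
  assumes "1 \<le> q" "q < 2" "k \<ge> 1"
  shows "level_const q k < level_star q k" "level_star q k < level_const q (k + 1)"
proof -
  have "level_const q k < level_star q k \<and> level_star q k < level_const q (k + 1)"
  proof (cases "1 < q")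
    case True
    then have "0 < conj_exponent q" by (simp add: conj_exponent_def)
    then show ?thesis
      using delta_star_between[OF True assms(2,3)] True
      by (simp add: level_const_def level_star_def)
  next
    case False
    then have [simp]: "q = 1" using assms by simp
    have "0 < eta_const 1 (k + 1)" using conc_constants_eq1(3) by simp
    then show ?thesis
      using eta_star_between[OF assms(3)]
      by (simp add: level_const_def level_star_def divide_strict_left_mono)
  qed
  then show "level_const q k < level_star q k" "level_star q k < level_const q (k + 1)" by auto
qed

section \<open>Concentrating solutions\<close>

text \<open>Here \<open>lam\<close>, \<open>\<mu>\<close> and \<open>u\<close> are already
  restricted to the subsequence on which the concentration sequences live.\<close>

locale concentrating_solutions =
  fixes h f :: "real \<Rightarrow> real"
    and t0 q :: real and p :: ereal
    and lam \<mu> :: "nat \<Rightarrow> real" and u :: "nat \<Rightarrow> real \<Rightarrow> real"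
    and r \<gamma> \<rho> \<rho>b :: "nat \<Rightarrow> nat \<Rightarrow> real"
  assumes h: "C1_on {0..1} h" "\<And>x. x \<in> {0..1} \<Longrightarrow> 0 < h x"
    and f: "\<And>t. 0 \<le> t \<Longrightarrow> 0 \<le> f t"
    and t0: "0 \<le> t0" "\<And>t. t0 \<le> t \<Longrightarrow> 0 < f t" "C2_on {t0..} f"
    and growth: "gen_exp_growth f t0 q p"
    and q: "1 \<le> q" "q < 2"
    and sol: "solution_seq h f lam \<mu> u"
    and \<mu>: "filterlim \<mu> at_top sequentially"
    and conc: "concentration_sequences q h f t0 lam \<mu> u r \<gamma> \<rho> \<rho>b"
begin

abbreviation "g \<equiv> log_of f"
abbreviation "g1 \<equiv> wderiv {t0..} g"
abbreviation "g2 \<equiv> wderiv {t0..} g1"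

sublocale convex_growth g g1 g2 t0 q
proof
  show "1 \<le> q" by (rule q)
  show "(g has_real_derivative g1 t) (at t)" "(g1 has_real_derivative g2 t) (at t)" if "t0 < t" for t
    using log_of_growth[OF t0 that] by blast+
  show "0 < g1 t" "0 < g2 t" if "t0 < t" for t
    using growth less_imp_le[OF that] unfolding gen_exp_growth_def Let_def by blast+
  show "((\<lambda>t. (g1 t)\<^sup>2 / (g t * g2 t)) \<longlongrightarrow> q) at_top"
    using growth unfolding gen_exp_growth_def Let_def by blast
qed

sublocale sol: radial_solution h f "u n" "lam n" for n
proof
  show "C2_on {0..1} (u n)"
    using sol unfolding solution_seq_def by blast
  show "- wderiv {0..1} (wderiv {0..1} (u n)) x - 1 / x * wderiv {0..1} (u n) x = lam n * h x * f (u n x)"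
    if "x \<in> {0<..<1}" for x
    using sol that unfolding solution_seq_def by blast
  show "0 \<le> lam n * h x * f (u n x)" if "x \<in> {0<..<1}" for x
  proof -
    have "0 < lam n" "0 < u n x" using sol that unfolding solution_seq_def by blast+
    then show ?thesis using h(2)[of x] f[of "u n x"] that by simp
  qed
qed

lemma lam_pos: "0 < lam n" and u_at_0: "u n 0 = \<mu> n"
  using sol unfolding solution_seq_def by blast+

lemma u_le: "0 \<le> x \<Longrightarrow> x \<le> 1 \<Longrightarrow> u n x \<le> \<mu> n"
  using sol.u_antimono[of 0 x n] by (simp add: u_at_0)

section \<open>Heights and radii at a single bubble\<close>

context
  fixes k :: nat
  assumes k: "k \<ge> 1"
begin

lemmas conc_k = conc[unfolded concentration_sequences_def Let_def, THEN conjunct2, THEN spec, THEN mp[OF _ k]]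

lemma conc_pos: "r k n \<in> {0<..<1}" "0 < \<gamma> k n" "\<rho> k n \<in> {0..<1}" "\<rho>b k n \<in> {0..<1}"
  by (insert conc_k[THEN conjunct1, THEN spec, of n]) (elim conjE, assumption)+

lemma conc_levels:
  assumes "s \<in> {r k, \<rho> k, \<rho>b k}"
  shows "(\<lambda>n. u n (s n) / \<mu> n) \<longlonglongrightarrow> delta_const q k"
    "q = 1 \<Longrightarrow> peak_expansion f t0 \<mu> (\<lambda>n. u n (s n)) (ln (1 / eta_const q k))"
  using bspec[OF conc_k[THEN conjunct2, THEN conjunct1] assms] by simp_all

lemma conc_scales:
  "(\<lambda>n. lam n * (r k n)\<^sup>2 * h (r k n) * wderiv {0..} f (u n (r k n))) \<longlonglongrightarrow> (a_const q k)\<^sup>2 / 2"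
  "\<forall>\<^sub>F n in sequentially. lam n * h (r k n) * wderiv {0..} f (u n (r k n)) * (\<gamma> k n)\<^sup>2 = 1"
  "\<gamma> k \<longlonglongrightarrow> 0" "(\<lambda>n. \<rho>b k n / \<gamma> k n) \<longlonglongrightarrow> 0"
  "filterlim (\<lambda>n. \<rho> k n / \<gamma> k n) at_top sequentially"
  by (insert conc_k) (elim conjE, assumption)+

lemma conc_profile:
  "C2_loc_conv (\<lambda>n. 1 / \<gamma> k n) (\<lambda>n x. g1 (u n (r k n)) * (u n (\<gamma> k n * x) - u n (r k n)))
     (z_dom k) (z_prof q k)"
  using conc_k by (elim conjE)

lemma conc_mass:
  "(\<lambda>n. g1 (u n (r k n)) * integral {\<rho>b k n..\<rho> k n} (\<lambda>x. lam n * h x * f (u n x) * x))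
     \<longlonglongrightarrow> 2 * a_const q k"
  "(\<lambda>n. g1 (\<mu> n) * integral {\<rho> k n..\<rho>b (k + 1) n} (\<lambda>x. lam n * h x * f (u n x) * x)) \<longlonglongrightarrow> 0"
  by (insert conc_k) (elim conjE, assumption)+

lemma log_lam:
  assumes "q > 1 \<or> linear_lower_bound f"
  shows "(\<lambda>n. ln (1 / lam n) / g (\<mu> n)) \<longlonglongrightarrow> 0"
proof -
  have "q > 1 \<or> q = 1 \<and> linear_lower_bound f" using assms q by auto
  moreover have "q > 1 \<or> q = 1 \<and> linear_lower_bound f \<longrightarrow>
      (\<lambda>n. ln (1 / lam n) / g (\<mu> n)) \<longlonglongrightarrow> 0 \<and>
      (\<lambda>n. ln (1 / r k n) / g (\<mu> n)) \<longlonglongrightarrow> eta_const q k / 2"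
    using conc_k by (elim conjE)
  ultimately show ?thesis by blast
qed

lemma log_\<rho>: "(\<lambda>n. ln (\<rho> k n / \<gamma> k n) / g (u n (r k n))) \<longlonglongrightarrow> 0"
  using conc_k by (elim conjE)

text \<open>For \<open>q = 1\<close> the ratio to \<open>\<mu>\<close> only tends to
  \<open>1\<close> and does not separate the bubbles, so the level is read off from the finer peak
  expansion.\<close>

lemma conc_level:
  assumes "s \<in> {r k, \<rho> k, \<rho>b k}"
  shows "(\<lambda>n. (\<mu> n - u n (s n)) / G (\<mu> n)) \<longlonglongrightarrow> level_const q k"
proof (cases "1 < q")
  case True
  then show ?thesis
    using level_of_ratio[OF True \<mu> conc_levels(1)[OF assms]] by (simp add: level_const_def)
next
  case False
  then have "q = 1" using q by simp
  then obtain \<epsilon> where \<epsilon>: "\<epsilon> \<longlonglongrightarrow> 0"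
    "\<forall>\<^sub>F n in sequentially. u n (s n) = \<mu> n - (ln (1 / eta_const q k) + \<epsilon> n) * (g (\<mu> n) / g1 (\<mu> n))"
    using conc_levels(2)[OF assms] unfolding peak_expansion_def by blast
  have "(\<lambda>n. ln (1 / eta_const q k) + \<epsilon> n) \<longlonglongrightarrow> ln (1 / eta_const q k) + 0"
    by (intro tendsto_intros \<epsilon>)
  moreover have "\<forall>\<^sub>F n in sequentially. ln (1 / eta_const q k) + \<epsilon> n = (\<mu> n - u n (s n)) / G (\<mu> n)"
    using eventually_G_pos[OF \<mu>] \<epsilon>(2) by eventually_elim (auto simp flip: G_def)
  ultimately have "(\<lambda>n. (\<mu> n - u n (s n)) / G (\<mu> n)) \<longlonglongrightarrow> ln (1 / eta_const q k) + 0"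
    by (rule Lim_transform_eventually)
  then show ?thesis using False by (simp add: level_const_def)
qed

lemma conc_range:
  assumes "s \<in> {r k, \<rho> k, \<rho>b k}"
  shows "0 \<le> s n" "s n \<le> 1"
  using assms conc_pos[of n] by (auto simp: less_imp_le)

lemma conc_values:
  assumes "s \<in> {r k, \<rho> k, \<rho>b k}"
  shows "filterlim (\<lambda>n. u n (s n)) at_top sequentially"
    "(\<lambda>n. G (u n (s n)) / G (\<mu> n)) \<longlonglongrightarrow> decay (level_const q k)"
    "(\<lambda>n. g (u n (s n)) / g (\<mu> n)) \<longlonglongrightarrow> height (level_const q k)"
    "0 < decay (level_const q k)" "0 < height (level_const q k)"
proof -
  have "\<forall>\<^sub>F n in sequentially. u n (s n) \<le> \<mu> n"
    by (intro always_eventually allI u_le conc_range[OF assms])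
  note * = level[OF \<mu> this conc_level[OF assms] level_const_range(2)[OF q k]]
  show "filterlim (\<lambda>n. u n (s n)) at_top sequentially"
    "(\<lambda>n. G (u n (s n)) / G (\<mu> n)) \<longlonglongrightarrow> decay (level_const q k)"
    "(\<lambda>n. g (u n (s n)) / g (\<mu> n)) \<longlonglongrightarrow> height (level_const q k)"
    "0 < decay (level_const q k)" "0 < height (level_const q k)"
    using * by auto
qed

lemma eventually_centre: "\<forall>\<^sub>F n in sequentially. t0 < u n (r k n) \<and> 0 < g (u n (r k n))"
  using eventually_g_pos conc_values(1)[of "r k"] unfolding filterlim_iff by blast

text \<open>Both \<open>r\<close> and \<open>\<gamma>\<close> are normalised by the same quantity
  \<open>\<lambda> h f'\<close> at the centre, which cancels in the quotient.\<close>

lemma r_over_\<gamma>: "(\<lambda>n. r k n / \<gamma> k n) \<longlonglongrightarrow> a_const q k / sqrt 2"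
proof -
  have "(\<lambda>n. sqrt (lam n * (r k n)\<^sup>2 * h (r k n) * wderiv {0..} f (u n (r k n))))
      \<longlonglongrightarrow> sqrt ((a_const q k)\<^sup>2 / 2)"
    by (intro tendsto_real_sqrt conc_scales)
  moreover have "sqrt ((a_const q k)\<^sup>2 / 2) = a_const q k / sqrt 2"
    using a_const_range[OF q k] by (simp add: real_sqrt_divide)
  moreover have "\<forall>\<^sub>F n in sequentially.
      sqrt (lam n * (r k n)\<^sup>2 * h (r k n) * wderiv {0..} f (u n (r k n))) = r k n / \<gamma> k n"
    using conc_scales(2)
  proof eventually_elim
    case (elim n)
    have "lam n * (r k n)\<^sup>2 * h (r k n) * wderiv {0..} f (u n (r k n)) =
        (r k n / \<gamma> k n)\<^sup>2 * (lam n * h (r k n) * wderiv {0..} f (u n (r k n)) * (\<gamma> k n)\<^sup>2)"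
      using conc_pos(2)[of n] by (simp add: field_simps)
    then show ?case using elim conc_pos[of n] by (simp add: less_imp_le)
  qed
  ultimately show ?thesis by (auto elim: Lim_transform_eventually)
qed

lemma r_tendsto_0: "r k \<longlonglongrightarrow> 0"
proof -
  have "(\<lambda>n. r k n / \<gamma> k n * \<gamma> k n) \<longlonglongrightarrow> a_const q k / sqrt 2 * 0"
    by (intro tendsto_mult r_over_\<gamma> conc_scales)
  then show ?thesis using conc_pos(2) by (simp add: less_imp_neq[symmetric])
qed

lemma centre_identity:
  "(\<lambda>n. g (u n (r k n)) + ln (g1 (u n (r k n)))
     - (2 * ln (1 / (sqrt (lam n) * r k n)) + ln ((a_const q k)\<^sup>2 / (2 * h 0)))) \<longlonglongrightarrow> 0"
proof -
  have "continuous_on {0..1} h"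
    using h(1) by (simp add: C1_on_def differentiable_imp_continuous_on)
  then have "(\<lambda>n. h (r k n)) \<longlonglongrightarrow> h 0"
    by (rule continuous_on_tendsto_compose[OF _ r_tendsto_0])
       (use conc_pos(1) in \<open>auto intro!: always_eventually simp: less_imp_le\<close>)
  moreover have h0: "0 < h 0" using h(2) by simp
  moreover have a: "0 < a_const q k" using a_const_range[OF q k] by simp
  ultimately have "(\<lambda>n. ln (lam n * (r k n)\<^sup>2 * h (r k n) * wderiv {0..} f (u n (r k n))) - ln (h (r k n))
      - ln ((a_const q k)\<^sup>2 / (2 * h 0)))
      \<longlonglongrightarrow> ln ((a_const q k)\<^sup>2 / 2) - ln (h 0) - ln ((a_const q k)\<^sup>2 / (2 * h 0))"
    by (intro tendsto_intros conc_scales) auto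
  moreover have "ln ((a_const q k)\<^sup>2 / 2) - ln (h 0) - ln ((a_const q k)\<^sup>2 / (2 * h 0)) = 0"
    using a h0 by (simp add: ln_div ln_mult)
  moreover have "\<forall>\<^sub>F n in sequentially.
      ln (lam n * (r k n)\<^sup>2 * h (r k n) * wderiv {0..} f (u n (r k n))) - ln (h (r k n))
        - ln ((a_const q k)\<^sup>2 / (2 * h 0))
      = g (u n (r k n)) + ln (g1 (u n (r k n)))
     - (2 * ln (1 / (sqrt (lam n) * r k n)) + ln ((a_const q k)\<^sup>2 / (2 * h 0)))"
    using eventually_centre
  proof eventually_elim
    case (elim n)
    define t where "t = u n (r k n)"
    have t: "t0 < t" using elim by (simp add: t_def)
    have pos: "0 < f t" "0 < g1 t" "0 < r k n" "0 < h (r k n)" "0 < lam n"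
      using t0(2)[of t] t g1_pos[of t] conc_pos(1)[of n] h(2)[of "r k n"] lam_pos[of n] by auto
    have "ln (lam n * (r k n)\<^sup>2 * h (r k n) * (f t * g1 t)) =
        ln (lam n) + 2 * ln (r k n) + ln (h (r k n)) + g t + ln (g1 t)"
      using pos by (simp add: ln_mult ln_realpow log_of_def)
    moreover have "2 * ln (1 / (sqrt (lam n) * r k n)) = - ln (lam n) - 2 * ln (r k n)"
      using pos by (simp add: ln_div ln_mult ln_sqrt)
    ultimately show ?case
      using log_of_growth(3)[OF t0 t] by (simp flip: t_def)
  qed
  ultimately show ?thesis by (auto elim: Lim_transform_eventually)
qed

text \<open>Divide \<open>centre_identity\<close> by \<open>g\<close> at the centre: the constant,
  the error and \<open>ln g1\<close> all become negligible.\<close>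

lemma log_centre:
  "(\<lambda>n. ln (1 / (sqrt (lam n) * r k n)) / g (u n (r k n))) \<longlonglongrightarrow> 1 / 2"
proof -
  define C where "C = ln ((a_const q k)\<^sup>2 / (2 * h 0))"
  define E where "E = (\<lambda>n. g (u n (r k n)) + ln (g1 (u n (r k n)))
     - (2 * ln (1 / (sqrt (lam n) * r k n)) + C))"
  have s: "filterlim (\<lambda>n. u n (r k n)) at_top sequentially" by (rule conc_values) simp
  have inv: "(\<lambda>n. inverse (g (u n (r k n)))) \<longlonglongrightarrow> 0"
    by (intro tendsto_inverse_0_at_top filterlim_compose[OF g_at_top s])
  have E: "E \<longlonglongrightarrow> 0" unfolding E_def C_def by (rule centre_identity)
  have "(\<lambda>n. (1 + ln (g1 (u n (r k n))) / g (u n (r k n)) - (E n + C) * inverse (g (u n (r k n)))) / 2)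
      \<longlonglongrightarrow> (1 + 0 - (0 + C) * 0) / 2"
    by (intro tendsto_intros E inv filterlim_compose[OF ln_g1_over_g s]) auto
  moreover have "\<forall>\<^sub>F n in sequentially.
      (1 + ln (g1 (u n (r k n))) / g (u n (r k n)) - (E n + C) * inverse (g (u n (r k n)))) / 2
      = ln (1 / (sqrt (lam n) * r k n)) / g (u n (r k n))"
    using eventually_centre by eventually_elim (simp add: E_def field_simps)
  ultimately show ?thesis by (auto elim: Lim_transform_eventually)
qed

section \<open>The flux across a bubble\<close>

lemma flux_profile:
  assumes "0 < x"
  shows "(\<lambda>n. g1 (u n (r k n)) * sol.flux n (\<gamma> k n * x)) \<longlonglongrightarrow> profile_flux q k x"
proof -
  define \<zeta> where "\<zeta> = (\<lambda>n x. g1 (u n (r k n)) * (u n (\<gamma> k n * x) - u n (r k n)))"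
  \<comment> \<open>The convergence of first derivatives is applied on the compact set
    \<open>{x}\<close>, which lies in \<open>z_dom k\<close> for every \<open>k\<close> as
    \<open>x > 0\<close>.\<close>
  have "uniform_limit {x} (\<lambda>n. wderiv {0..1 / \<gamma> k n} (\<zeta> n)) (wderiv (z_dom k) (z_prof q k)) sequentially"
  proof -
    have "compact {x}" "{x} \<subseteq> z_dom k" using assms by (auto simp: z_dom_def)
    then show ?thesis using conc_profile unfolding C2_loc_conv_def \<zeta>_def by blast
  qed
  then have "(\<lambda>n. wderiv {0..1 / \<gamma> k n} (\<zeta> n) x) \<longlonglongrightarrow> wderiv (z_dom k) (z_prof q k) x"
    by (rule tendsto_uniform_limitI) simp
  then have "(\<lambda>n. - (x * wderiv {0..1 / \<gamma> k n} (\<zeta> n) x)) \<longlonglongrightarrow> - (x * wderiv (z_dom k) (z_prof q k) x)"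
    by (intro tendsto_intros)
  moreover have "\<forall>\<^sub>F n in sequentially. \<gamma> k n * x < 1"
    using tendsto_mult[OF conc_scales(3) tendsto_const[of x]]
    by (intro order_tendstoD(2)[of _ 0]) auto
  then have "\<forall>\<^sub>F n in sequentially.
      - (x * wderiv {0..1 / \<gamma> k n} (\<zeta> n) x) = g1 (u n (r k n)) * sol.flux n (\<gamma> k n * x)"
    unfolding \<zeta>_def by eventually_elim (rule sol.rescaled_flux; use conc_pos assms in auto)
  ultimately show ?thesis
    using z_prof_flux[OF q k assms] by (auto elim: Lim_transform_eventually)
qed

lemma eventually_\<rho>:
  "\<forall>\<^sub>F n in sequentially. \<gamma> k n * x \<le> \<rho> k n"
proof -
  have "\<forall>\<^sub>F n in sequentially. x \<le> \<rho> k n / \<gamma> k n"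
    using conc_scales(5) unfolding filterlim_at_top by blast
  then show ?thesis
    by eventually_elim (use conc_pos(2) in \<open>simp add: field_simps\<close>)
qed

lemma eventually_\<rho>b:
  assumes "0 < x"
  shows "\<forall>\<^sub>F n in sequentially. \<rho>b k n \<le> \<gamma> k n * x"
  using order_tendstoD(2)[OF conc_scales(4) assms]
  by eventually_elim (use conc_pos(2) in \<open>simp add: field_simps less_imp_le\<close>)

text \<open>The limiting profile has flux \<open>2 - a\<close> at \<open>0\<close> and \<open>2 + a\<close> at infinity. As the flux is
  monotone, this and the mass \<open>2 a\<close> of the bubble pin down the flux at \<open>\<rho>\<close>.\<close>

lemma flux_at_\<rho>:
  "(\<lambda>n. g1 (u n (r k n)) * sol.flux n (\<rho> k n)) \<longlonglongrightarrow> 2 + a_const q k"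
proof (rule order_tendstoI)
  define m where "m = (\<lambda>n. g1 (u n (r k n)))"
  have m: "\<forall>\<^sub>F n in sequentially. 0 < m n"
    using eventually_centre by eventually_elim (simp add: m_def g1_pos)
  show "\<forall>\<^sub>F n in sequentially. y < g1 (u n (r k n)) * sol.flux n (\<rho> k n)"
    if "y < 2 + a_const q k" for y
  proof -
    \<comment> \<open>Lower bound: at a large fixed \<open>x\<close> the profile flux exceeds
      \<open>y\<close>, and \<open>\<gamma> x\<close> eventually lies below
      \<open>\<rho>\<close>.\<close>
    have "\<forall>\<^sub>F x in at_top. y < profile_flux q k x \<and> 0 < x"
      using order_tendstoD(1)[OF profile_flux_limits(2)[OF q k] that] eventually_gt_at_top[of 0]
      by eventually_elim auto
    from eventually_happens'[OF trivial_limit_at_top_linorder this]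
    obtain x where x: "y < profile_flux q k x" "0 < x" by blast
    show ?thesis
      using order_tendstoD(1)[OF flux_profile[OF x(2)] x(1)] eventually_\<rho>[of x] m
    proof eventually_elim
      case (elim n)
      have "sol.flux n (\<gamma> k n * x) \<le> sol.flux n (\<rho> k n)"
        using elim conc_pos[of n] x by (intro sol.flux_mono) auto
      then have "m n * sol.flux n (\<gamma> k n * x) \<le> m n * sol.flux n (\<rho> k n)"
        using elim by (intro mult_left_mono) auto
      then show ?case using elim unfolding m_def by linarith
    qed
  qed
  show "\<forall>\<^sub>F n in sequentially. g1 (u n (r k n)) * sol.flux n (\<rho> k n) < y"
    if "2 + a_const q k < y" for y
  proof -
    \<comment> \<open>Upper bound: one half of the gap is spent on the flux at
      \<open>\<rho>b\<close>, controlled by the profile at a small \<open>x\<close>, the other half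
      on the mass of the bubble.\<close>
    define e where "e = (y - (2 + a_const q k)) / 2"
    have e: "0 < e" using that by (simp add: e_def)
    have "2 - a_const q k < 2 - a_const q k + e" using e by simp
    from order_tendstoD(2)[OF profile_flux_limits(1)[OF q k] this]
      eventually_at_right_less[of "0::real"]
    have "\<forall>\<^sub>F x in at_right 0. profile_flux q k x < 2 - a_const q k + e \<and> 0 < x"
      by eventually_elim auto
    from eventually_happens'[OF trivial_limit_at_right_real this]
    obtain x where x: "profile_flux q k x < 2 - a_const q k + e" "0 < x" by blast
    have "\<forall>\<^sub>F n in sequentially. m n *
        integral {\<rho>b k n..\<rho> k n} (\<lambda>x. lam n * h x * f (u n x) * x) < 2 * a_const q k + e"
      unfolding m_def using e by (intro order_tendstoD(2)[OF conc_mass(1)]) auto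
    then show ?thesis
      using order_tendstoD(2)[OF flux_profile[OF x(2)] x(1)] eventually_\<rho>[of x]
        eventually_\<rho>b[OF x(2)] m
    proof eventually_elim
      case (elim n)
      have "m n * sol.flux n (\<rho>b k n) \<le> m n * sol.flux n (\<gamma> k n * x)"
        using elim conc_pos[of n] x by (intro mult_left_mono sol.flux_mono) auto
      moreover have "m n * integral {\<rho>b k n..\<rho> k n} (\<lambda>x. lam n * h x * f (u n x) * x)
          = m n * sol.flux n (\<rho> k n) - m n * sol.flux n (\<rho>b k n)"
        using elim conc_pos[of n] by (subst sol.integral_source) (auto simp: right_diff_distrib)
      ultimately have "m n * sol.flux n (\<rho> k n) < 2 + a_const q k + 2 * e"
        using elim unfolding m_def by linarith
      moreover have "2 * e = y - (2 + a_const q k)" by (simp add: e_def)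
      ultimately show ?case unfolding m_def by linarith
    qed
  qed
qed

text \<open>The radius \<open>r\<close> is comparable with \<open>\<gamma>\<close>, whereas
  \<open>\<rho>\<close> is of larger order.\<close>

lemma r_less_\<rho>: "\<forall>\<^sub>F n in sequentially. r k n < \<rho> k n"
proof -
  have "\<forall>\<^sub>F n in sequentially. r k n / \<gamma> k n < a_const q k / sqrt 2 + 1"
    by (rule order_tendstoD(2)[OF r_over_\<gamma>]) simp
  with eventually_\<rho>[of "a_const q k / sqrt 2 + 1"] show ?thesis
  proof eventually_elim
    case (elim n)
    have "r k n = \<gamma> k n * (r k n / \<gamma> k n)" using conc_pos(2)[of n] by simp
    also have "\<dots> < \<gamma> k n * (a_const q k / sqrt 2 + 1)"
      using elim conc_pos(2)[of n] by (intro mult_strict_left_mono)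
    finally show ?case using elim by linarith
  qed
qed

lemma \<rho>b_less_r: "\<forall>\<^sub>F n in sequentially. \<rho>b k n < r k n"
proof -
  have x: "0 < a_const q k / sqrt 2 / 2" using a_const_range[OF q k] by simp
  have "\<forall>\<^sub>F n in sequentially. a_const q k / sqrt 2 / 2 < r k n / \<gamma> k n"
    by (rule order_tendstoD(1)[OF r_over_\<gamma>]) (use x in simp)
  with eventually_\<rho>b[OF x] show ?thesis
  proof eventually_elim
    case (elim n)
    have "\<gamma> k n * (a_const q k / sqrt 2 / 2) < \<gamma> k n * (r k n / \<gamma> k n)"
      using elim conc_pos(2)[of n] by (intro mult_strict_left_mono)
    also have "\<dots> = r k n" using conc_pos(2)[of n] by simp
    finally show ?case using elim by linarith
  qed
qed

text \<open>Replaces the unit \<open>G \<mu>\<close> by \<open>G\<close> at the centre, which costs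
  the factor \<open>decay\<close>.\<close>

lemma level_gap:
  assumes "s \<in> {r k, \<rho> k, \<rho>b k}" "((\<lambda>n. (\<mu> n - v n) / G (\<mu> n)) \<longlonglongrightarrow> c)"
  shows "(\<lambda>n. (u n (s n) - v n) / G (u n (r k n))) \<longlonglongrightarrow> (c - level_const q k) / decay (level_const q k)"
proof -
  have r: "r k \<in> {r k, \<rho> k, \<rho>b k}" by simp
  have "(\<lambda>n. ((\<mu> n - v n) / G (\<mu> n) - (\<mu> n - u n (s n)) / G (\<mu> n)) / (G (u n (r k n)) / G (\<mu> n)))
      \<longlonglongrightarrow> (c - level_const q k) / decay (level_const q k)"
    using conc_values(4)[OF r]
    by (intro tendsto_intros assms conc_level conc_values(2)[OF r]) auto
  moreover have "\<forall>\<^sub>F n in sequentially.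
      ((\<mu> n - v n) / G (\<mu> n) - (\<mu> n - u n (s n)) / G (\<mu> n)) / (G (u n (r k n)) / G (\<mu> n))
      = (u n (s n) - v n) / G (u n (r k n))"
    using eventually_G_pos[OF \<mu>] by eventually_elim (simp flip: diff_divide_distrib)
  ultimately show ?thesis by (rule Lim_transform_eventually)
qed

end

section \<open>The region between two consecutive bubbles\<close>

lemma intermediate_radii:
  assumes k: "k \<ge> 1" and c: "level_const q k < c" "c < level_const q (k + 1)"
  obtains r' where "\<forall>\<^sub>F n in sequentially.
    \<rho> k n < r' n \<and> r' n < \<rho>b (k + 1) n \<and> u n (r' n) = \<mu> n - c * G (\<mu> n)"
proof -
  have k': "k + 1 \<ge> 1" by simp
  have "\<forall>\<^sub>F n in sequentially. (\<mu> n - u n (\<rho> k n)) / G (\<mu> n) < c"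
    by (rule order_tendstoD(2)[OF conc_level[OF k] c(1)]) simp
  moreover have "\<forall>\<^sub>F n in sequentially. c < (\<mu> n - u n (\<rho>b (k + 1) n)) / G (\<mu> n)"
    by (rule order_tendstoD(1)[OF conc_level[OF k'] c(2)]) simp
  ultimately have "\<forall>\<^sub>F n in sequentially.
    \<exists>x. \<rho> k n < x \<and> x < \<rho>b (k + 1) n \<and> u n x = \<mu> n - c * G (\<mu> n)"
    using eventually_G_pos[OF \<mu>]
  proof eventually_elim
    case (elim n)
    define v where "v = \<mu> n - c * G (\<mu> n)"
    have v: "v < u n (\<rho> k n)" "u n (\<rho>b (k + 1) n) < v"
      using elim by (simp_all add: v_def field_simps)
    have range: "0 \<le> \<rho> k n" "\<rho> k n < 1" "0 \<le> \<rho>b (k + 1) n" "\<rho>b (k + 1) n < 1"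
      using conc_pos(3)[OF k, of n] conc_pos(4)[OF k', of n] by auto
    \<comment> \<open>The order of these two radii is deduced from the values there, since
      \<open>u n\<close> is nonincreasing.\<close>
    have le: "\<rho> k n \<le> \<rho>b (k + 1) n"
      using sol.u_antimono[of "\<rho>b (k + 1) n" "\<rho> k n" n] v range by linarith
    have "\<exists>x\<ge>\<rho> k n. x \<le> \<rho>b (k + 1) n \<and> u n x = v"
      by (rule IVT2'[OF _ _ le continuous_on_subset[OF sol.continuous_u]]) (use v range in auto)
    then obtain x where x: "\<rho> k n \<le> x" "x \<le> \<rho>b (k + 1) n" "u n x = v" by blast
    then have "x \<noteq> \<rho> k n" "x \<noteq> \<rho>b (k + 1) n" using v by auto
    then show ?case using x by (intro exI[of _ x]) (auto simp: v_def)
  qed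
  then have "\<forall>\<^sub>F n in sequentially. (\<lambda>x. \<rho> k n < x \<and> x < \<rho>b (k + 1) n \<and> u n x = \<mu> n - c * G (\<mu> n))
      (SOME x. \<rho> k n < x \<and> x < \<rho>b (k + 1) n \<and> u n x = \<mu> n - c * G (\<mu> n))"
    by eventually_elim (rule someI_ex)
  then show thesis by (rule that)
qed

text \<open>The flux can increase only by the mass between the bubbles. Convexity gives
  \<open>g1\<close> at the centre at most \<open>g1 (\<mu> n)\<close>, and the mass multiplied by
  the latter tends to zero.\<close>

lemma flux_between:
  assumes k: "k \<ge> 1" and \<xi>: "\<forall>\<^sub>F n in sequentially. \<rho> k n \<le> \<xi> n \<and> \<xi> n \<le> \<rho>b (k + 1) n"
  shows "(\<lambda>n. g1 (u n (r k n)) * sol.flux n (\<xi> n)) \<longlonglongrightarrow> 2 + a_const q k"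
proof -
  define I where "I = (\<lambda>n. integral {\<rho> k n..\<rho>b (k + 1) n} (\<lambda>x. lam n * h x * f (u n x) * x))"
  have upper: "(\<lambda>n. g1 (u n (r k n)) * sol.flux n (\<rho> k n) + g1 (\<mu> n) * I n) \<longlonglongrightarrow> 2 + a_const q k + 0"
    unfolding I_def by (intro tendsto_intros flux_at_\<rho>[OF k] conc_mass[OF k])
  have bounds: "\<forall>\<^sub>F n in sequentially.
      g1 (u n (r k n)) * sol.flux n (\<rho> k n) \<le> g1 (u n (r k n)) * sol.flux n (\<xi> n) \<and>
      g1 (u n (r k n)) * sol.flux n (\<xi> n)
        \<le> g1 (u n (r k n)) * sol.flux n (\<rho> k n) + g1 (\<mu> n) * I n"
    using \<xi> eventually_centre[OF k]
  proof eventually_elim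
    case (elim n)
    have range: "0 \<le> \<rho> k n" "\<rho>b (k + 1) n < 1"
      using conc_pos(3)[OF k, of n] conc_pos(4)[of "k + 1" n] by auto
    have m: "0 < g1 (u n (r k n))" "g1 (u n (r k n)) \<le> g1 (\<mu> n)"
      using elim conc_pos(1)[OF k, of n] by (auto intro!: g1_pos g1_mono u_le simp: less_imp_le)
    have fl: "sol.flux n (\<rho> k n) \<le> sol.flux n (\<xi> n)" "sol.flux n (\<xi> n) \<le> sol.flux n (\<rho>b (k + 1) n)"
      using elim range by (auto intro!: sol.flux_mono)
    have I: "I n = sol.flux n (\<rho>b (k + 1) n) - sol.flux n (\<rho> k n)"
      unfolding I_def using elim range by (intro sol.integral_source) auto
    have "g1 (u n (r k n)) * (sol.flux n (\<xi> n) - sol.flux n (\<rho> k n)) \<le> g1 (u n (r k n)) * I n"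
      using m fl by (intro mult_left_mono) (auto simp: I)
    also have "\<dots> \<le> g1 (\<mu> n) * I n" using m fl by (intro mult_right_mono) (auto simp: I)
    finally show ?case using m fl by (simp add: right_diff_distrib)
  qed
  show ?thesis
    by (rule tendsto_sandwich[OF _ _ flux_at_\<rho>[OF k] upper[unfolded add_0_right]])
       (use bounds in \<open>auto elim: eventually_mono\<close>)
qed

text \<open>Pass from \<open>r\<close> to \<open>r'\<close> through \<open>\<gamma>\<close> and
  \<open>\<rho>\<close>. Relative to \<open>g\<close> at the centre,
  \<open>ln (r / \<gamma>)\<close> and \<open>ln (\<rho> / \<gamma>)\<close> vanish,
  \<open>log_centre\<close> contributes \<open>1/2\<close>, and \<open>ln (r' / \<rho>)\<close> is
  the drop of \<open>u\<close> divided by the flux.\<close>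

lemma log_between:
  assumes k: "k \<ge> 1"
    and r': "\<forall>\<^sub>F n in sequentially. \<rho> k n < r' n \<and> r' n < \<rho>b (k + 1) n"
    and c: "(\<lambda>n. (\<mu> n - u n (r' n)) / G (\<mu> n)) \<longlonglongrightarrow> c"
  shows "(\<lambda>n. ln (1 / (sqrt (lam n) * r' n)) / g (u n (r k n))) \<longlonglongrightarrow>
    1 / 2 - (c - level_const q k) / decay (level_const q k) / (2 + a_const q k)"
proof -
  have a: "0 < a_const q k" using a_const_range[OF q k] by simp
  have r\<rho>: "\<forall>\<^sub>F n in sequentially. 0 < \<rho> k n"
    using r_less_\<rho>[OF k]
  proof eventually_elim
    case (elim n)
    then show ?case using conc_pos(1)[OF k, of n] by auto
  qed
  have "\<exists>\<xi>. \<rho> k n < \<xi> \<and> \<xi> < r' n \<and> u n (\<rho> k n) - u n (r' n) = sol.flux n \<xi> * ln (r' n / \<rho> k n)"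
    if "0 < \<rho> k n" "\<rho> k n < r' n" "r' n < \<rho>b (k + 1) n" for n
  proof -
    have "r' n < 1" using that conc_pos(4)[of "k + 1" n] by auto
    from sol.drop_between[OF that(1,2) this, of n] show ?thesis by blast
  qed
  then obtain \<xi> where \<xi>: "\<And>n. 0 < \<rho> k n \<Longrightarrow> \<rho> k n < r' n \<Longrightarrow> r' n < \<rho>b (k + 1) n \<Longrightarrow>
      \<rho> k n < \<xi> n \<and> \<xi> n < r' n \<and> u n (\<rho> k n) - u n (r' n) = sol.flux n (\<xi> n) * ln (r' n / \<rho> k n)"
    by metis
  have "\<forall>\<^sub>F n in sequentially. \<rho> k n \<le> \<xi> n \<and> \<xi> n \<le> \<rho>b (k + 1) n"
    using r' r\<rho>
  proof eventually_elim
    case (elim n)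
    with \<xi>[of n] show ?case by auto
  qed
  note fl = flux_between[OF k this]
  have s: "filterlim (\<lambda>n. u n (r k n)) at_top sequentially" by (rule conc_values[OF k]) simp
  have inv: "(\<lambda>n. inverse (g (u n (r k n)))) \<longlonglongrightarrow> 0"
    by (intro tendsto_inverse_0_at_top filterlim_compose[OF g_at_top s])
  have "(\<lambda>n. ln (1 / (sqrt (lam n) * r k n)) / g (u n (r k n))
        + ln (r k n / \<gamma> k n) * inverse (g (u n (r k n)))
        - ln (\<rho> k n / \<gamma> k n) / g (u n (r k n))
        - (u n (\<rho> k n) - u n (r' n)) / G (u n (r k n)) / (g1 (u n (r k n)) * sol.flux n (\<xi> n)))
      \<longlonglongrightarrow> 1 / 2 + ln (a_const q k / sqrt 2) * 0 - 0
        - (c - level_const q k) / decay (level_const q k) / (2 + a_const q k)"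
    by (intro tendsto_intros log_centre[OF k] r_over_\<gamma>[OF k] inv log_\<rho>[OF k]
        level_gap[OF k _ c] fl) (use a in auto)
  \<comment> \<open>A nonzero flux allows the mean value identity to be solved for
    \<open>ln (r' n / \<rho> k n)\<close>.\<close>
  moreover have "\<forall>\<^sub>F n in sequentially. 0 < g1 (u n (r k n)) * sol.flux n (\<xi> n)"
    by (rule order_tendstoD(1)[OF fl]) (use a in simp)
  then have "\<forall>\<^sub>F n in sequentially.
      ln (1 / (sqrt (lam n) * r k n)) / g (u n (r k n))
        + ln (r k n / \<gamma> k n) * inverse (g (u n (r k n)))
        - ln (\<rho> k n / \<gamma> k n) / g (u n (r k n))
        - (u n (\<rho> k n) - u n (r' n)) / G (u n (r k n)) / (g1 (u n (r k n)) * sol.flux n (\<xi> n))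
      = ln (1 / (sqrt (lam n) * r' n)) / g (u n (r k n))"
    using r' r\<rho> eventually_centre[OF k]
  proof eventually_elim
    case (elim n)
    have pos: "0 < r k n" "0 < \<gamma> k n" "0 < lam n" "0 < r' n" "0 < \<rho> k n" "0 < g1 (u n (r k n))"
      using elim conc_pos[OF k, of n] lam_pos[of n] by (auto intro: g1_pos)
    then have "sol.flux n (\<xi> n) \<noteq> 0" using elim by auto
    then have "(u n (\<rho> k n) - u n (r' n)) / G (u n (r k n)) / (g1 (u n (r k n)) * sol.flux n (\<xi> n))
        = ln (r' n / \<rho> k n) / g (u n (r k n))"
      using \<xi>[of n] elim pos by (simp add: G_def)
    moreover have "ln (1 / (sqrt (lam n) * r k n)) + ln (r k n / \<gamma> k n) - ln (\<rho> k n / \<gamma> k n)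
        - ln (r' n / \<rho> k n) = ln (1 / (sqrt (lam n) * r' n))"
      using pos by (simp add: ln_div ln_mult)
    moreover have "A / z + B * inverse z - C / z - D / z = (A + B - C - D) / z" for A B C D z :: real
      by (simp add: divide_inverse algebra_simps)
    ultimately show ?case by simp
  qed
  ultimately show ?thesis by (auto elim: Lim_transform_eventually)
qed

section \<open>Identification of the constants and conclusion\<close>

text \<open>Relative to \<open>g\<close> at the centre, the logarithm of the intermediate radius has
  limit \<open>\<beta>\<close> and \<open>g\<close> there the quotient of heights. With
  \<open>x\<close> the ratio of \<open>delta_star\<close> to \<open>\<delta>\<close>, these are
  \<open>x / (2 + a)\<close> and \<open>x powr p\<close> for \<open>q > 1\<close>, and
  \<open>1 / (2 + a)\<close> and \<open>exp (- a / 2)\<close> for \<open>q = 1\<close>.\<close>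

lemma alpha_star_identity:
  assumes k: "k \<ge> 1"
  defines "\<beta> \<equiv> 1 / 2 - (level_star q k - level_const q k) / decay (level_const q k) / (2 + a_const q k)"
  shows "0 < \<beta>" "height (level_star q k) / height (level_const q k) = alpha_star q k * \<beta>"
proof -
  define a where "a = a_const q k"
  have a: "0 < a" using a_const_range[OF q k] by (simp add: a_def)
  have "0 < \<beta> \<and> height (level_star q k) / height (level_const q k) = alpha_star q k * \<beta>"
  proof (cases "1 < q")
    case True
    define p where "p = conj_exponent q"
    define x where "x = 1 - a / (2 * (p - 1))"
    define d where "d = delta_const q k"
    have p: "2 < p" using True q by (simp add: p_def conj_exponent_def field_simps)
    have x: "0 < x" using delta_star_between(1)[OF True q(2) k] by (simp add: x_def a_def p_def)
    have d: "0 < d" using conc_constants_gt1(3)[OF True q(2) k] by (simp add: d_def)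
    have star: "delta_star q k = x * d" by (simp add: delta_star_def x_def d_def a_def p_def)
    \<comment> \<open>At the level of the \<open>k\<close>-th bubble, \<open>decay\<close> equals
      \<open>\<delta>\<close>, which cancels from the difference of levels.\<close>
    have gap: "(level_star q k - level_const q k) / decay (level_const q k) = p * (1 - x)"
      using True p d by (simp add: level_star_def level_const_def decay_def star
          right_diff_distrib flip: p_def d_def) (simp add: field_simps)
    have "(p - 1) * (1 - x) = a / 2" using p by (simp add: x_def field_simps)
    then have "p * (1 - x) = (2 + a) / 2 - x" by (simp add: algebra_simps)
    then have "\<beta> = x / (2 + a)"
      using a unfolding \<beta>_def gap by (simp add: diff_divide_distrib flip: a_def)
    moreover have "height (level_star q k) = (x * d) powr p" "height (level_const q k) = d powr p"
      using True p by (simp_all add: level_star_def level_const_def height_def star flip: p_def d_def)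
    moreover have "alpha_star q k = (2 + a) * x powr (p - 1)"
      using True by (simp add: alpha_star_def x_def a_def p_def)
    ultimately show ?thesis
      using a x d by (simp add: powr_mult powr_diff)
  next
    case False
    then have "q = 1" using q by simp
    then have e: "0 < eta_const q k" using conc_constants_eq1(3)[OF k] by simp
    have gap: "level_star q k - level_const q k = a / 2"
      using e False by (simp add: level_star_def level_const_def eta_star_def ln_div ln_mult a_def)
    have "\<beta> = 1 / 2 - a / 2 / (2 + a)"
      using False unfolding \<beta>_def gap by (simp add: decay_def flip: a_def)
    then have "\<beta> = 1 / (2 + a)" using a by (simp add: field_simps)
    moreover have "height (level_star q k) / height (level_const q k)
        = exp (- (level_star q k - level_const q k))"
      using False by (simp add: height_def flip: exp_diff)
    ultimately show ?thesis
      using a False by (simp add: gap alpha_star_def flip: a_def)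
  qed
  then show "0 < \<beta>" "height (level_star q k) / height (level_const q k) = alpha_star q k * \<beta>"
    by auto
qed

text \<open>The factor \<open>sqrt (lam n)\<close> contributes \<open>ln (1 / lam n) / 2\<close>,
  which is negligible against \<open>g (\<mu> n)\<close> and hence against the comparable value of
  \<open>g\<close> at the centre.\<close>

lemma log_radius:
  assumes k: "k \<ge> 1" and lower: "q = 1 \<longrightarrow> linear_lower_bound f"
    and x: "\<forall>\<^sub>F n in sequentially. 0 < x n"
    and lim: "(\<lambda>n. ln (1 / (sqrt (lam n) * x n)) / g (u n (r k n))) \<longlonglongrightarrow> b"
  shows "(\<lambda>n. ln (1 / x n) / g (u n (r k n))) \<longlonglongrightarrow> b"
proof -
  have r: "r k \<in> {r k, \<rho> k, \<rho>b k}" by simp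
  have "q > 1 \<or> linear_lower_bound f" using lower q by auto
  then have "(\<lambda>n. ln (1 / (sqrt (lam n) * x n)) / g (u n (r k n))
      - (ln (1 / lam n) / g (\<mu> n)) / (g (u n (r k n)) / g (\<mu> n)) / 2)
      \<longlonglongrightarrow> b - 0 / height (level_const q k) / 2"
    using conc_values(5)[OF k r]
    by (intro tendsto_intros lim log_lam[OF k] conc_values(3)[OF k r]) auto
  moreover have "\<forall>\<^sub>F n in sequentially. t0 < \<mu> n \<and> 0 < g (\<mu> n)"
    using eventually_g_pos \<mu> unfolding filterlim_iff by blast
  then have "\<forall>\<^sub>F n in sequentially. ln (1 / (sqrt (lam n) * x n)) / g (u n (r k n))
      - (ln (1 / lam n) / g (\<mu> n)) / (g (u n (r k n)) / g (\<mu> n)) / 2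
      = ln (1 / x n) / g (u n (r k n))"
    using x
  proof eventually_elim
    case (elim n)
    have "ln (1 / (sqrt (lam n) * x n)) = ln (1 / x n) + ln (1 / lam n) / 2"
      using lam_pos[of n] elim by (simp add: ln_div ln_mult ln_sqrt)
    then show ?case using elim by (simp add: add_divide_distrib)
  qed
  ultimately show ?thesis by (auto elim: Lim_transform_eventually)
qed

lemma concentration_expansions:
  assumes k: "k \<ge> 1"
  shows "\<exists>r'. (\<forall>\<^sub>F n in sequentially. r' n \<in> {r k n<..<r (k + 1) n}) \<and>
       (q > 1 \<longrightarrow> (\<lambda>n. u n (r' n) / \<mu> n) \<longlonglongrightarrow> delta_star q k) \<and>
       (q = 1 \<longrightarrow> peak_expansion f t0 \<mu> (\<lambda>n. u n (r' n)) (ln (1 / eta_star q k))) \<and>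
       asymp_factor (\<lambda>n. g (u n (r' n))) (alpha_star q k) (\<lambda>n. ln (1 / (sqrt (lam n) * r' n))) \<and>
       ((q = 1 \<longrightarrow> linear_lower_bound f) \<longrightarrow>
          asymp_factor (\<lambda>n. g (u n (r k n))) 2 (\<lambda>n. ln (1 / r k n)) \<and>
          asymp_factor (\<lambda>n. g (u n (r' n))) (alpha_star q k) (\<lambda>n. ln (1 / r' n)))"
proof -
  define c where "c = level_star q k"
  define \<beta> where "\<beta> = 1 / 2 - (c - level_const q k) / decay (level_const q k) / (2 + a_const q k)"
  have k': "k + 1 \<ge> 1" by simp
  have rk: "r k \<in> {r k, \<rho> k, \<rho>b k}" by simp
  note c = level_star_between[OF q k, folded c_def]
  obtain r' where r': "\<forall>\<^sub>F n in sequentially.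
      \<rho> k n < r' n \<and> r' n < \<rho>b (k + 1) n \<and> u n (r' n) = \<mu> n - c * G (\<mu> n)"
    using intermediate_radii[OF k c] by blast
  then have between: "\<forall>\<^sub>F n in sequentially. \<rho> k n < r' n \<and> r' n < \<rho>b (k + 1) n"
    by eventually_elim simp
  have pos: "\<forall>\<^sub>F n in sequentially. 0 < r' n"
    using between
  proof eventually_elim
    case (elim n)
    then show ?case using conc_pos(3)[OF k, of n] by auto
  qed
  have "(\<lambda>n. c) \<longlonglongrightarrow> c" by simp
  \<comment> \<open>The intermediate value theorem attains level \<open>c\<close> exactly, so its
    limit is that of an eventually constant sequence.\<close>
  moreover have "\<forall>\<^sub>F n in sequentially. c = (\<mu> n - u n (r' n)) / G (\<mu> n)"
    using r' eventually_G_pos[OF \<mu>] by eventually_elim simp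
  ultimately have lev: "(\<lambda>n. (\<mu> n - u n (r' n)) / G (\<mu> n)) \<longlonglongrightarrow> c"
    by (rule Lim_transform_eventually)
  have le: "\<forall>\<^sub>F n in sequentially. u n (r' n) \<le> \<mu> n"
    using between pos
  proof eventually_elim
    case (elim n)
    then show ?case using conc_pos(4)[OF k', of n] by (intro u_le) auto
  qed
  have cp: "c < conj_exponent q" if "1 < q"
    using c(2) level_const_range(2)[OF q k' that] by linarith
  note lev_r' = level[OF \<mu> le lev cp]
  have g_pos: "\<forall>\<^sub>F n in sequentially. t0 < \<mu> n \<and> 0 < g (\<mu> n)"
    using eventually_g_pos \<mu> unfolding filterlim_iff by blast
  have beta: "0 < \<beta>" "height c / height (level_const q k) = alpha_star q k * \<beta>"
    using alpha_star_identity[OF k] by (simp_all add: \<beta>_def c_def)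
  have "(\<lambda>n. g (u n (r' n)) / g (\<mu> n) / (g (u n (r k n)) / g (\<mu> n)))
      \<longlonglongrightarrow> height c / height (level_const q k)"
    using conc_values(5)[OF k rk] by (intro tendsto_divide lev_r'(5) conc_values(3)[OF k rk]) auto
  moreover have "\<forall>\<^sub>F n in sequentially. g (u n (r' n)) / g (\<mu> n) / (g (u n (r k n)) / g (\<mu> n))
      = g (u n (r' n)) / g (u n (r k n))"
    using g_pos by eventually_elim simp
  ultimately have ratio: "(\<lambda>n. g (u n (r' n)) / g (u n (r k n))) \<longlonglongrightarrow> alpha_star q k * \<beta>"
    unfolding beta(2) by (rule Lim_transform_eventually)
  have log': "(\<lambda>n. ln (1 / (sqrt (lam n) * r' n)) / g (u n (r k n))) \<longlonglongrightarrow> \<beta>"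
    unfolding \<beta>_def by (rule log_between[OF k between lev])
  have "\<forall>\<^sub>F n in sequentially. 1 = g (u n (r k n)) / g (u n (r k n))"
    using eventually_centre[OF k] by eventually_elim simp
  \<comment> \<open>The limit \<open>1\<close> is written as \<open>2 * (1 / 2)\<close> to fit
    \<open>asymp_factorI\<close>, with \<open>1 / 2\<close> the limit in
    \<open>log_centre\<close>.\<close>
  then have one: "(\<lambda>n. g (u n (r k n)) / g (u n (r k n))) \<longlonglongrightarrow> 2 * (1 / 2)"
    by (rule Lim_transform_eventually[rotated]) simp
  show ?thesis
  proof (intro exI[of _ r'] conjI impI)
    show "\<forall>\<^sub>F n in sequentially. r' n \<in> {r k n<..<r (k + 1) n}"
      \<comment> \<open>The chain is
        \<open>r k < \<rho> k < r' < \<rho>b (k + 1) < r (k + 1)\<close>, eventually.\<close>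
      using between r_less_\<rho>[OF k] \<rho>b_less_r[OF k'] by eventually_elim auto
    show "(\<lambda>n. u n (r' n) / \<mu> n) \<longlonglongrightarrow> delta_star q k" if "q > 1"
    proof -
      have "1 - c / conj_exponent q = delta_star q k"
        using that by (simp add: c_def level_star_def conj_exponent_def)
      then show ?thesis using ratio_of_level[OF that \<mu> lev] by simp
    qed
    show "peak_expansion f t0 \<mu> (\<lambda>n. u n (r' n)) (ln (1 / eta_star q k))" if "q = 1"
      unfolding peak_expansion_def
    proof (intro exI[of _ "\<lambda>_. 0"] conjI)
      have c_eq: "c = ln (1 / eta_star q k)" using that by (simp add: c_def level_star_def)
      from r' show "\<forall>\<^sub>F n in sequentially. u n (r' n)
          = \<mu> n - (ln (1 / eta_star q k) + 0) * (g (\<mu> n) / g1 (\<mu> n))"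
        by eventually_elim (simp add: G_def c_eq)
    qed simp
    show "asymp_factor (\<lambda>n. g (u n (r' n))) (alpha_star q k) (\<lambda>n. ln (1 / (sqrt (lam n) * r' n)))"
      using beta(1) by (intro asymp_factorI[OF ratio log']) simp
    assume lower: "q = 1 \<longrightarrow> linear_lower_bound f"
    have rpos: "\<forall>\<^sub>F n in sequentially. 0 < r k n" using conc_pos(1)[OF k] by simp
    show "asymp_factor (\<lambda>n. g (u n (r k n))) 2 (\<lambda>n. ln (1 / r k n))"
      by (rule asymp_factorI[OF one log_radius[OF k lower rpos log_centre[OF k]]]) simp
    show "asymp_factor (\<lambda>n. g (u n (r' n))) (alpha_star q k) (\<lambda>n. ln (1 / r' n))"
      using beta(1) by (intro asymp_factorI[OF ratio log_radius[OF k lower pos log']]) simp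
  qed
qed

end

theorem corollary2p4:
  fixes h f :: "real \<Rightarrow> real"
    and t0 q :: real and p :: ereal
    and lam \<mu> :: "nat \<Rightarrow> real" and u :: "nat \<Rightarrow> real \<Rightarrow> real"
    and \<sigma> :: "nat \<Rightarrow> nat"
    and r \<gamma> \<rho> \<rho>b :: "nat \<Rightarrow> nat \<Rightarrow> real"
  assumes h: "C1_on {0..1} h" "\<And>x. x \<in> {0..1} \<Longrightarrow> 0 < h x"
    and f: "C1_on {0..} f" "\<And>t. 0 \<le> t \<Longrightarrow> 0 \<le> f t"
    and t0: "0 \<le> t0" "\<And>t. t0 \<le> t \<Longrightarrow> 0 < f t" "C2_on {t0..} f"
    and growth: "gen_exp_growth f t0 q p"
    and q: "1 \<le> q" "q < 2"
    and sol: "solution_seq h f lam \<mu> u"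
    and \<mu>: "filterlim \<mu> at_top sequentially"
    \<comment> \<open>\<open>\<sigma>\<close> selects the subsequence along which the concentration sequences are fixed\<close>
    and \<sigma>: "strict_mono \<sigma>"
    and conc: "concentration_sequences q h f t0 (lam \<circ> \<sigma>) (\<mu> \<circ> \<sigma>) (u \<circ> \<sigma>) r \<gamma> \<rho> \<rho>b"
  defines "g \<equiv> log_of f"
  defines "g' \<equiv> wderiv {t0..} g"
  shows "\<forall>k\<ge>1.
    (\<lambda>n. g (u (\<sigma> n) (r k n)) + ln (g' (u (\<sigma> n) (r k n)))
         - (2 * ln (1 / (sqrt (lam (\<sigma> n)) * r k n)) + ln ((a_const q k)\<^sup>2 / (2 * h 0)))) \<longlonglongrightarrow> 0 \<and>
    (\<exists>r'. (\<forall>\<^sub>F n in sequentially. r' n \<in> {r k n<..<r (k + 1) n}) \<and>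
       (q > 1 \<longrightarrow> (\<lambda>n. u (\<sigma> n) (r' n) / \<mu> (\<sigma> n)) \<longlonglongrightarrow> delta_star q k) \<and>
       (q = 1 \<longrightarrow>
          peak_expansion f t0 (\<mu> \<circ> \<sigma>) (\<lambda>n. u (\<sigma> n) (r' n)) (ln (1 / eta_star q k))) \<and>
       asymp_factor (\<lambda>n. g (u (\<sigma> n) (r' n))) (alpha_star q k)
         (\<lambda>n. ln (1 / (sqrt (lam (\<sigma> n)) * r' n))) \<and>
       ((q = 1 \<longrightarrow> linear_lower_bound f) \<longrightarrow>
          asymp_factor (\<lambda>n. g (u (\<sigma> n) (r k n))) 2 (\<lambda>n. ln (1 / r k n)) \<and>
          asymp_factor (\<lambda>n. g (u (\<sigma> n) (r' n))) (alpha_star q k) (\<lambda>n. ln (1 / r' n))))"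
proof (intro allI impI conjI)
  fix k :: nat
  assume k: "1 \<le> k"
  \<comment> \<open>The solutions are composed with \<open>\<sigma>\<close>, while the concentration
    sequences are already indexed along the subsequence.\<close>
  interpret concentrating_solutions h f t0 q p "lam \<circ> \<sigma>" "\<mu> \<circ> \<sigma>" "u \<circ> \<sigma>" r \<gamma> \<rho> \<rho>b
  proof
    show "solution_seq h f (lam \<circ> \<sigma>) (\<mu> \<circ> \<sigma>) (u \<circ> \<sigma>)"
      using sol unfolding solution_seq_def comp_def by blast
    show "filterlim (\<mu> \<circ> \<sigma>) at_top sequentially"
      unfolding comp_def by (rule filterlim_compose[OF \<mu> filterlim_subseq[OF \<sigma>]])
  qed (use h f t0 growth q conc in \<open>assumption | blast\<close>)+
  show "(\<lambda>n. g (u (\<sigma> n) (r k n)) + ln (g' (u (\<sigma> n) (r k n)))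
         - (2 * ln (1 / (sqrt (lam (\<sigma> n)) * r k n)) + ln ((a_const q k)\<^sup>2 / (2 * h 0)))) \<longlonglongrightarrow> 0"
    using centre_identity[OF k] unfolding g_def g'_def comp_def .
  show "\<exists>r'. (\<forall>\<^sub>F n in sequentially. r' n \<in> {r k n<..<r (k + 1) n}) \<and>
       (q > 1 \<longrightarrow> (\<lambda>n. u (\<sigma> n) (r' n) / \<mu> (\<sigma> n)) \<longlonglongrightarrow> delta_star q k) \<and>
       (q = 1 \<longrightarrow>
          peak_expansion f t0 (\<mu> \<circ> \<sigma>) (\<lambda>n. u (\<sigma> n) (r' n)) (ln (1 / eta_star q k))) \<and>
       asymp_factor (\<lambda>n. g (u (\<sigma> n) (r' n))) (alpha_star q k)
         (\<lambda>n. ln (1 / (sqrt (lam (\<sigma> n)) * r' n))) \<and>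
       ((q = 1 \<longrightarrow> linear_lower_bound f) \<longrightarrow>
          asymp_factor (\<lambda>n. g (u (\<sigma> n) (r k n))) 2 (\<lambda>n. ln (1 / r k n)) \<and>
          asymp_factor (\<lambda>n. g (u (\<sigma> n) (r' n))) (alpha_star q k) (\<lambda>n. ln (1 / r' n)))"
    using concentration_expansions[OF k] unfolding g_def comp_def .
qed

end
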